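(* In the setting described in the context, let $u,v,w,f\in C_0(E)\cap D(\mathcal{E})$. Then (i) $d\mu^c_{\langle uv,w\rangle}=u\,d\mu^c_{\langle v,w\rangle}+v\,d\mu^c_{\langle u,w\rangle}$; (ii) $\langle L(u,vw),f\rangle=\langle L(u,v),wf\rangle$; (iii) $\langle L(uv,w),f\rangle=\langle L(u,w),vf\rangle+\langle L(v,w),uf\rangle$.
   Context: $E$ is a locally compact separable metric space with metric $\rho$, $m$ a positive Radon measure on $E$ with $\mathrm{supp}[m]=E$, $(\cdot,\cdot)$ the inner product of $L^2(E;m)$, $d$ the diagonal of $E\times E$, and $(\mathcal{E},D(\mathcal{E}))$ a regular semi-Dirichlet form on $L^2(E;m)$ with co-resolvent $(\hat G_\beta)$. Standing assumption: for $f,g\in C_0(E)\cap D(\mathcal{E})$, $fg\in C_0(E)\cap D(\mathcal{E})$ and $(f(y)-f(x))g(y)$ is $J$-integrable. $J$ (positive Radon on $E\times E\setminus d$) and $K$ (positive Radon on $E$) are the jumping and killing measures: the unique measures with $\mathcal{E}(u,v)=\int_{E\times E\setminus d}2(u(y)-u(x))v(y)J(dxdy)+\int_E uv\,dK$ whenever $v\in C_0(E)\cap D(\mathcal{E})$ and $u\in C_0(E)\cap D(\mathcal{E})$ is constant on a neighbourhood of $\mathrm{supp}[v]$. $\hat\sigma_\beta$ is the positive Radon measure on $E\times E$ with $(\beta\hat G_\beta u,v)=\int u(x)v(y)\hat\sigma_\beta(dxdy)$. Fix relatively compact open $\Omega_l\uparrow E$, $\varsigma_l\downarrow0$ with $\{(x,y)\in\Omega_l^2:\rho(x,y)\ge\varsigma_l\}$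 a $J$-continuity set, and $\Lambda_l:=\{(x,y)\in\Omega_l^2:\rho(x,y)<\varsigma_l\}$. For $u,v\in C_0(E)\cap D(\mathcal{E})$: $\mathcal{E}^c(u,v):=\mathcal{E}(u,v)-\int_{E\times E\setminus d}2(u(y)-u(x))v(y)J(dxdy)-\int_E uv\,dK$; $\hat{\mathcal{E}}^c(u,v):=\lim_l\lim_{\beta\to\infty}\beta\int_{\Lambda_l}(u(y)-u(x))v(y)\hat\sigma_\beta(dxdy)$ (the limit exists); $\mu^c_{\langle u,v\rangle}$ is the unique signed Radon measure on $E$ with $\int_E f\,d\mu^c_{\langle u,v\rangle}=\mathcal{E}^c(u,vf)+\mathcal{E}^c(v,uf)-\mathcal{E}^c(uv,f)$ for all $f\in C_0(E)\cap D(\mathcal{E})$; $\langle L(u,v),f\rangle:=\frac12(\mathcal{E}^c(u,vf)-\hat{\mathcal{E}}^c(u,vf))$ for $f\in C_0(E)\cap D(\mathcal{E})$. *)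

theory Defs
  imports "HOL-Analysis.Analysis"
begin

text \<open>C_0(E): continuous real functions with compact support (Fukushima's convention).\<close>
definition supp :: "('a::topological_space \<Rightarrow> real) \<Rightarrow> 'a set" where
  "supp f = closure {x. f x \<noteq> 0}"

definition C0 :: "('a::metric_space \<Rightarrow> real) set" where
  "C0 = {f. continuous_on UNIV f \<and> compact (supp f)}"

definition L2 :: "'a measure \<Rightarrow> ('a \<Rightarrow> real) set" where
  "L2 m = {f. f \<in> borel_measurable m \<and> integrable m (\<lambda>x. (f x)\<^sup>2)}"

definition inner_L2 :: "'a measure \<Rightarrow> ('a \<Rightarrow> real) \<Rightarrow> ('a \<Rightarrow> real) \<Rightarrow> real" where
  "inner_L2 m f g = (\<integral>x. f x * g x \<partial>m)"

text \<open>Positive Radon measure on a locally compact separable metric space: a Borel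
  measure which is finite on compact sets.\<close>
definition radon_measure :: "'a::metric_space measure \<Rightarrow> bool" where
  "radon_measure M \<longleftrightarrow> sets M = sets borel \<and> (\<forall>C. compact C \<longrightarrow> emeasure M C < \<infinity>)"

definition diag :: "('a \<times> 'a) set" where
  "diag = {p. fst p = snd p}"

text \<open>Positive Radon measure on E x E minus the diagonal, viewed as a Borel measure on
  E x E not charging the diagonal and finite on compact subsets of E x E minus d.\<close>
definition radon_measure_offdiag :: "('a::metric_space \<times> 'a) measure \<Rightarrow> bool" where
  "radon_measure_offdiag J \<longleftrightarrow> sets J = sets borel \<and> emeasure J diag = 0 \<and>
     (\<forall>C. compact C \<and> C \<inter> diag = {} \<longrightarrow> emeasure J C < \<infinity>)"

text \<open>Signed Radon measures are represented as pairs (P, N) of positive Radon measures,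
  standing for P - N (on relatively compact Borel sets).\<close>
definition signed_radon :: "'a::metric_space measure \<times> 'a measure \<Rightarrow> bool" where
  "signed_radon \<mu> \<longleftrightarrow> radon_measure (fst \<mu>) \<and> radon_measure (snd \<mu>)"

definition sint :: "'a measure \<times> 'a measure \<Rightarrow> ('a \<Rightarrow> real) \<Rightarrow> real" where
  "sint \<mu> g = (\<integral>x. g x \<partial>(fst \<mu>)) - (\<integral>x. g x \<partial>(snd \<mu>))"

text \<open>Elements of L^2 are represented by functions; D is closed under m-a.e. modification
  and the form does not see such modifications.\<close>

definition E1norm :: "'a measure \<Rightarrow> (('a\<Rightarrow>real) \<Rightarrow> ('a\<Rightarrow>real) \<Rightarrow> real) \<Rightarrow> ('a\<Rightarrow>real) \<Rightarrow> real" where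
  "E1norm m \<E> u = \<E> u u + inner_L2 m u u"

definition semi_dirichlet_form ::
  "'a measure \<Rightarrow> ('a\<Rightarrow>real) set \<Rightarrow> (('a\<Rightarrow>real) \<Rightarrow> ('a\<Rightarrow>real) \<Rightarrow> real) \<Rightarrow> bool" where
  "semi_dirichlet_form m D \<E> \<longleftrightarrow>
     D \<subseteq> L2 m
   \<and> (\<forall>u\<in>D. \<forall>v. v \<in> borel_measurable m \<and> (AE x in m. u x = v x) \<longrightarrow>
          v \<in> D \<and> (\<forall>w\<in>D. \<E> u w = \<E> v w \<and> \<E> w u = \<E> w v))
   \<and> (\<forall>u\<in>D. \<forall>v\<in>D. \<forall>a b::real. (\<lambda>x. a * u x + b * v x) \<in> D)
   \<and> (\<forall>u\<in>D. \<forall>v\<in>D. \<forall>w\<in>D. \<forall>a b::real.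
          \<E> (\<lambda>x. a * u x + b * v x) w = a * \<E> u w + b * \<E> v w \<and>
          \<E> w (\<lambda>x. a * u x + b * v x) = a * \<E> w u + b * \<E> w v)
   \<and> (\<forall>f\<in>L2 m. \<forall>e>0. \<exists>u\<in>D. inner_L2 m (\<lambda>x. f x - u x) (\<lambda>x. f x - u x) < e)
   \<and> (\<forall>u\<in>D. \<E> u u \<ge> 0)
   \<and> (\<exists>Kc>0. \<forall>u\<in>D. \<forall>v\<in>D.
          \<bar>\<E> u v + inner_L2 m u v\<bar> \<le> Kc * sqrt (E1norm m \<E> u) * sqrt (E1norm m \<E> v))
   \<and> (\<forall>s::nat \<Rightarrow> ('a \<Rightarrow> real). (\<forall>n. s n \<in> D) \<and>
          (\<forall>e>0. \<exists>N. \<forall>n\<ge>N. \<forall>k\<ge>N. E1norm m \<E> (\<lambda>x. s n x - s k x) < e) \<longrightarrow>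
          (\<exists>w\<in>D. (\<lambda>n. E1norm m \<E> (\<lambda>x. s n x - w x)) \<longlonglongrightarrow> 0))
   \<and> (\<forall>u\<in>D. (\<lambda>x. min (max (u x) 0) 1) \<in> D \<and>
          \<E> (\<lambda>x. u x + min (max (u x) 0) 1) (\<lambda>x. u x - min (max (u x) 0) 1) \<ge> 0)"

definition regular_form ::
  "'a::metric_space measure \<Rightarrow> ('a\<Rightarrow>real) set \<Rightarrow> (('a\<Rightarrow>real) \<Rightarrow> ('a\<Rightarrow>real) \<Rightarrow> real) \<Rightarrow> bool" where
  "regular_form m D \<E> \<longleftrightarrow>
     (\<forall>u\<in>D. \<forall>e>0. \<exists>f\<in>C0 \<inter> D. E1norm m \<E> (\<lambda>x. u x - f x) < e)
   \<and> (\<forall>g\<in>C0. \<forall>e>0. \<exists>f\<in>C0 \<inter> D. \<forall>x. \<bar>g x - f x\<bar> < e)"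

definition co_resolvent ::
  "'a measure \<Rightarrow> ('a\<Rightarrow>real) set \<Rightarrow> (('a\<Rightarrow>real) \<Rightarrow> ('a\<Rightarrow>real) \<Rightarrow> real)
     \<Rightarrow> (real \<Rightarrow> ('a\<Rightarrow>real) \<Rightarrow> ('a\<Rightarrow>real)) \<Rightarrow> bool" where
  "co_resolvent m D \<E> G \<longleftrightarrow>
     (\<forall>\<beta>>0. \<forall>f\<in>L2 m. G \<beta> f \<in> D \<and>
        (\<forall>u\<in>D. \<E> u (G \<beta> f) + \<beta> * inner_L2 m u (G \<beta> f) = inner_L2 m u f))"

definition standing_assumption ::
  "('a::metric_space\<Rightarrow>real) set \<Rightarrow> ('a \<times> 'a) measure \<Rightarrow> bool" where
  "standing_assumption D J \<longleftrightarrow>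
     (\<forall>f\<in>C0 \<inter> D. \<forall>g\<in>C0 \<inter> D. (\<lambda>x. f x * g x) \<in> C0 \<inter> D \<and>
        integrable J (\<lambda>p. (f (snd p) - f (fst p)) * g (snd p)))"

definition jumping_killing ::
  "('a::metric_space\<Rightarrow>real) set \<Rightarrow> (('a\<Rightarrow>real) \<Rightarrow> ('a\<Rightarrow>real) \<Rightarrow> real)
     \<Rightarrow> ('a \<times> 'a) measure \<Rightarrow> 'a measure \<Rightarrow> bool" where
  "jumping_killing D \<E> J K \<longleftrightarrow> radon_measure_offdiag J \<and> radon_measure K \<and>
     (\<forall>u\<in>C0 \<inter> D. \<forall>v\<in>C0 \<inter> D.
        (\<exists>U c. open U \<and> supp v \<subseteq> U \<and> (\<forall>x\<in>U. u x = c)) \<longrightarrow>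
        \<E> u v = (\<integral>p. 2 * (u (snd p) - u (fst p)) * v (snd p) \<partial>J) + (\<integral>x. u x * v x \<partial>K))"

definition co_resolvent_measures ::
  "'a::metric_space measure \<Rightarrow> (real \<Rightarrow> ('a\<Rightarrow>real) \<Rightarrow> ('a\<Rightarrow>real))
     \<Rightarrow> (real \<Rightarrow> ('a \<times> 'a) measure) \<Rightarrow> bool" where
  "co_resolvent_measures m G \<sigma> \<longleftrightarrow>
     (\<forall>\<beta>>0. radon_measure (\<sigma> \<beta>) \<and>
        (\<forall>u\<in>C0. \<forall>v\<in>C0.
           inner_L2 m (\<lambda>x. \<beta> * G \<beta> u x) v = (\<integral>p. u (fst p) * v (snd p) \<partial>(\<sigma> \<beta>))))"

definition exhaustion_data ::
  "('a::metric_space \<times> 'a) measure \<Rightarrow> (nat \<Rightarrow> 'a set) \<Rightarrow> (nat \<Rightarrow> real) \<Rightarrow> bool" where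
  "exhaustion_data J \<Omega> vs \<longleftrightarrow>
     (\<forall>l. open (\<Omega> l) \<and> compact (closure (\<Omega> l)) \<and> \<Omega> l \<subseteq> \<Omega> (Suc l))
   \<and> (\<Union>l. \<Omega> l) = UNIV
   \<and> (\<forall>l. vs l > 0) \<and> decseq vs \<and> vs \<longlonglongrightarrow> 0
   \<and> (\<forall>l. emeasure J (frontier {(x,y). x \<in> \<Omega> l \<and> y \<in> \<Omega> l \<and> dist x y \<ge> vs l}) = 0)"

definition Lambda :: "(nat \<Rightarrow> 'a::metric_space set) \<Rightarrow> (nat \<Rightarrow> real) \<Rightarrow> nat \<Rightarrow> ('a \<times> 'a) set" where
  "Lambda \<Omega> vs l = {(x,y). x \<in> \<Omega> l \<and> y \<in> \<Omega> l \<and> dist x y < vs l}"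

definition Ec ::
  "(('a\<Rightarrow>real) \<Rightarrow> ('a\<Rightarrow>real) \<Rightarrow> real) \<Rightarrow> ('a \<times> 'a) measure \<Rightarrow> 'a measure
     \<Rightarrow> ('a\<Rightarrow>real) \<Rightarrow> ('a\<Rightarrow>real) \<Rightarrow> real" where
  "Ec \<E> J K u v = \<E> u v - (\<integral>p. 2 * (u (snd p) - u (fst p)) * v (snd p) \<partial>J) - (\<integral>x. u x * v x \<partial>K)"

definition Ehatc ::
  "(real \<Rightarrow> ('a::metric_space \<times> 'a) measure) \<Rightarrow> (nat \<Rightarrow> 'a set) \<Rightarrow> (nat \<Rightarrow> real)
     \<Rightarrow> ('a\<Rightarrow>real) \<Rightarrow> ('a\<Rightarrow>real) \<Rightarrow> real" where
  "Ehatc \<sigma> \<Omega> vs u v =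
     lim (\<lambda>l. Lim at_top (\<lambda>\<beta>. \<beta> * (\<integral>p. indicator (Lambda \<Omega> vs l) p *
                 ((u (snd p) - u (fst p)) * v (snd p)) \<partial>(\<sigma> \<beta>))))"

definition energy_measures ::
  "('a::metric_space\<Rightarrow>real) set \<Rightarrow> (('a\<Rightarrow>real) \<Rightarrow> ('a\<Rightarrow>real) \<Rightarrow> real)
     \<Rightarrow> ('a \<times> 'a) measure \<Rightarrow> 'a measure
     \<Rightarrow> (('a\<Rightarrow>real) \<Rightarrow> ('a\<Rightarrow>real) \<Rightarrow> 'a measure \<times> 'a measure) \<Rightarrow> bool" where
  "energy_measures D \<E> J K \<mu> \<longleftrightarrow>
     (\<forall>u\<in>C0 \<inter> D. \<forall>v\<in>C0 \<inter> D. signed_radon (\<mu> u v) \<and>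
        (\<forall>f\<in>C0 \<inter> D. sint (\<mu> u v) f =
            Ec \<E> J K u (\<lambda>x. v x * f x) + Ec \<E> J K v (\<lambda>x. u x * f x)
            - Ec \<E> J K (\<lambda>x. u x * v x) f))"

definition Lop ::
  "(('a::metric_space\<Rightarrow>real) \<Rightarrow> ('a\<Rightarrow>real) \<Rightarrow> real) \<Rightarrow> ('a \<times> 'a) measure \<Rightarrow> 'a measure
     \<Rightarrow> (real \<Rightarrow> ('a \<times> 'a) measure) \<Rightarrow> (nat \<Rightarrow> 'a set) \<Rightarrow> (nat \<Rightarrow> real)
     \<Rightarrow> ('a\<Rightarrow>real) \<Rightarrow> ('a\<Rightarrow>real) \<Rightarrow> ('a\<Rightarrow>real) \<Rightarrow> real" where
  "Lop \<E> J K \<sigma> \<Omega> vs u v f =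
     (Ec \<E> J K u (\<lambda>x. v x * f x) - Ehatc \<sigma> \<Omega> vs u (\<lambda>x. v x * f x)) / 2"

end

theory Submission
  imports Defs
begin

text \<open>
  Let \<open>T\<^sub>\<beta>\<close> denote integration against \<open>\<beta> \<sigma>\<^sub>\<beta>\<close>. Since \<open>\<beta> ((q, p) - (q, \<beta> G\<^sub>\<beta> p)) \<rightarrow> \<E>(q, p)\<close>, where \<open>G\<close> is
  the co-resolvent, \<open>T\<^sub>\<beta>\<close> converges vaguely off the diagonal to \<open>2 J\<close> with its coordinates exchanged. A
  cut-off function \<open>h \<in> C0 \<inter> D\<close> that equals 1 near the supports involved absorbs the killing part, so that
  \<open>\<E>\<^sup>c(u, v f) + \<E>\<^sup>c(v, u f) - \<E>\<^sup>c(u v, f)\<close> is the limit, first in \<open>\<beta>\<close> and then in \<open>l\<close>, of the integrals of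
  \<open>(u(x) - u(y)) (v(x) - v(y)) f(x)\<close> over \<open>\<Lambda>\<^sub>l\<close>; the co-form gives the same expression with \<open>f(y)\<close> in place
  of \<open>f(x)\<close>. Both the difference of the two and the defect in the Leibniz rule are integrals of products
  of three increments, and these vanish in the limit: one increment is uniformly small on \<open>\<Lambda>\<^sub>l\<close>, the
  other two are bounded by energies.
\<close>

section \<open>Weak continuity of the form and the co-resolvent\<close>

lemma discriminant_nonneg_quadratic:
  fixes a b c :: real
  assumes "\<And>t. 0 \<le> a + 2 * t * c + t\<^sup>2 * b" and "0 \<le> b"
  shows "c\<^sup>2 \<le> a * b"
proof (cases "b = 0")
  case True
  have "c = 0"
  proof (rule ccontr)
    assume "c \<noteq> 0"
    then show False
      using assms(1)[of "- (a + 1) / (2 * c)"] True by (simp add: field_simps)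
  qed
  with True show ?thesis by simp
next
  case False
  with assms(2) have "b > 0" by simp
  then show ?thesis
    using assms(1)[of "- c / b"] by (simp add: field_simps power2_eq_square)
qed

lemma L2_integrable_mult:
  assumes "f \<in> L2 M" "g \<in> L2 M"
  shows "integrable M (\<lambda>x. f x * g x)"
proof (rule Bochner_Integration.integrable_bound)
  show "integrable M (\<lambda>x. (f x)\<^sup>2 + (g x)\<^sup>2)"
    using assms by (auto simp: L2_def)
  show "(\<lambda>x. f x * g x) \<in> borel_measurable M"
    using assms by (auto simp: L2_def)
  have "\<bar>a * b\<bar> \<le> a\<^sup>2 + b\<^sup>2" for a b :: real
  proof -
    have "2 * (\<bar>a\<bar> * \<bar>b\<bar>) \<le> a\<^sup>2 + b\<^sup>2"
      using sum_squares_bound[of "\<bar>a\<bar>" "\<bar>b\<bar>"] by simp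
    moreover have "0 \<le> \<bar>a\<bar> * \<bar>b\<bar>" by simp
    ultimately show ?thesis unfolding abs_mult by linarith
  qed
  then show "AE x in M. norm (f x * g x) \<le> norm ((f x)\<^sup>2 + (g x)\<^sup>2)"
    by (auto simp: real_norm_def)
qed

lemma inner_L2_commute: "inner_L2 M f g = inner_L2 M g f"
  by (simp add: inner_L2_def mult.commute)

lemma inner_L2_self_nonneg: "0 \<le> inner_L2 M f f"
  by (simp add: inner_L2_def)

lemma L2_lincomb:
  assumes "f \<in> L2 M" "g \<in> L2 M"
  shows "(\<lambda>x. a * f x + b * g x) \<in> L2 M"
proof -
  have "integrable M (\<lambda>x. a\<^sup>2 * (f x * f x) + 2 * a * b * (f x * g x) + b\<^sup>2 * (g x * g x))"
    using assms
    by (intro Bochner_Integration.integrable_add integrable_mult_right L2_integrable_mult)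
  then have "integrable M (\<lambda>x. (a * f x + b * g x)\<^sup>2)"
    by (simp add: power2_eq_square algebra_simps)
  with assms show ?thesis by (auto simp: L2_def)
qed

lemma inner_L2_lincomb_left:
  assumes "f \<in> L2 M" "g \<in> L2 M" "h \<in> L2 M"
  shows "inner_L2 M (\<lambda>x. a * f x + b * g x) h = a * inner_L2 M f h + b * inner_L2 M g h"
proof -
  have "inner_L2 M (\<lambda>x. a * f x + b * g x) h = (\<integral>x. a * (f x * h x) + b * (g x * h x) \<partial>M)"
    by (simp add: inner_L2_def algebra_simps)
  also have "\<dots> = a * inner_L2 M f h + b * inner_L2 M g h"
    using L2_integrable_mult[OF assms(1,3)] L2_integrable_mult[OF assms(2,3)]
    by (simp add: inner_L2_def)
  finally show ?thesis .
qed

lemma inner_L2_lincomb_right: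
  assumes "f \<in> L2 M" "g \<in> L2 M" "h \<in> L2 M"
  shows "inner_L2 M h (\<lambda>x. a * f x + b * g x) = a * inner_L2 M h f + b * inner_L2 M h g"
  using inner_L2_lincomb_left[OF assms] by (simp add: inner_L2_commute)

lemma inner_L2_Cauchy_Schwarz:
  assumes "f \<in> L2 M" "g \<in> L2 M"
  shows "\<bar>inner_L2 M f g\<bar> \<le> sqrt (inner_L2 M f f) * sqrt (inner_L2 M g g)"
proof -
  have "0 \<le> inner_L2 M f f + 2 * t * inner_L2 M f g + t\<^sup>2 * inner_L2 M g g" for t
  proof -
    have "0 \<le> inner_L2 M (\<lambda>x. 1 * f x + t * g x) (\<lambda>x. 1 * f x + t * g x)"
      by (rule inner_L2_self_nonneg)
    also have "\<dots> = inner_L2 M f f + 2 * t * inner_L2 M f g + t\<^sup>2 * inner_L2 M g g"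
      by (subst inner_L2_lincomb_left[OF assms L2_lincomb[OF assms]],
          subst (1 2) inner_L2_lincomb_right[OF assms])
        (use assms in \<open>auto simp: inner_L2_commute[of M g f] power2_eq_square algebra_simps\<close>)
    finally show ?thesis .
  qed
  then have "(inner_L2 M f g)\<^sup>2 \<le> inner_L2 M f f * inner_L2 M g g"
    by (rule discriminant_nonneg_quadratic) (rule inner_L2_self_nonneg)
  then show ?thesis
    by (metis real_sqrt_abs real_sqrt_le_mono real_sqrt_mult)
qed

locale sd_form =
  fixes m :: "'a measure" and D :: "('a \<Rightarrow> real) set"
    and \<E> :: "('a \<Rightarrow> real) \<Rightarrow> ('a \<Rightarrow> real) \<Rightarrow> real"
  assumes sdf: "semi_dirichlet_form m D \<E>"
begin

lemma D_L2: "u \<in> D \<Longrightarrow> u \<in> L2 m"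
  using sdf by (auto simp: semi_dirichlet_form_def)

lemma D_lincomb: "u \<in> D \<Longrightarrow> v \<in> D \<Longrightarrow> (\<lambda>x. a * u x + b * v x) \<in> D"
  using sdf unfolding semi_dirichlet_form_def by blast

lemma form_lincomb:
  assumes "u \<in> D" "v \<in> D" "w \<in> D"
  shows "\<E> (\<lambda>x. a * u x + b * v x) w = a * \<E> u w + b * \<E> v w"
    and "\<E> w (\<lambda>x. a * u x + b * v x) = a * \<E> w u + b * \<E> w v"
  using sdf assms unfolding semi_dirichlet_form_def by blast+

lemma form_nonneg: "u \<in> D \<Longrightarrow> 0 \<le> \<E> u u"
  using sdf unfolding semi_dirichlet_form_def by blast

lemma form_AE_zero:
  assumes "u \<in> D" "w \<in> D" "AE x in m. u x = 0"
  shows "\<E> w u = 0"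
proof -
  have "(\<lambda>x. 0) \<in> D" "\<E> w (\<lambda>x. 0) = 0"
    using D_lincomb[OF assms(1,1), of 0 0] form_lincomb(2)[OF assms(1,1,2), of 0 0] by auto
  moreover have "\<E> w u = \<E> w (\<lambda>x. 0)"
    using sdf assms(1,2,3) unfolding semi_dirichlet_form_def by fastforce
  ultimately show ?thesis by simp
qed

lemma D_unit_truncation: "u \<in> D \<Longrightarrow> (\<lambda>x. min (max (u x) 0) 1) \<in> D"
  using sdf unfolding semi_dirichlet_form_def by blast

lemma D_diff: "u \<in> D \<Longrightarrow> v \<in> D \<Longrightarrow> (\<lambda>x. u x - v x) \<in> D"
  using D_lincomb[of u v 1 "-1"] by simp

lemma D_scale: "u \<in> D \<Longrightarrow> (\<lambda>x. c * u x) \<in> D"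
  using D_lincomb[of u u c 0] by simp

lemma form_diff:
  assumes "u \<in> D" "v \<in> D" "w \<in> D"
  shows "\<E> (\<lambda>x. u x - v x) w = \<E> u w - \<E> v w" and "\<E> w (\<lambda>x. u x - v x) = \<E> w u - \<E> w v"
  using form_lincomb[OF assms, of 1 "-1"] by simp_all

lemma form_scale:
  assumes "u \<in> D" "w \<in> D"
  shows "\<E> (\<lambda>x. c * u x) w = c * \<E> u w" and "\<E> w (\<lambda>x. c * u x) = c * \<E> w u"
  using form_lincomb[OF assms(1,1,2), of c 0] by simp_all

lemma inner_diff:
  assumes "u \<in> D" "v \<in> D" "w \<in> D"
  shows "inner_L2 m (\<lambda>x. u x - v x) w = inner_L2 m u w - inner_L2 m v w"
    and "inner_L2 m w (\<lambda>x. u x - v x) = inner_L2 m w u - inner_L2 m w v"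
  using inner_L2_lincomb_left[of u m v w 1 "-1"] inner_L2_lincomb_right[of u m v w 1 "-1"]
    assms D_L2 by simp_all

lemma inner_le_E1norm: "u \<in> D \<Longrightarrow> inner_L2 m u u \<le> E1norm m \<E> u"
  by (simp add: E1norm_def form_nonneg)

lemma E1norm_nonneg: "u \<in> D \<Longrightarrow> 0 \<le> E1norm m \<E> u"
  using inner_le_E1norm inner_L2_self_nonneg order_trans by blast

lemma form_bounded:
  obtains C where "C > 0"
    and "\<And>u v. u \<in> D \<Longrightarrow> v \<in> D \<Longrightarrow> \<bar>\<E> u v\<bar> \<le> C * (sqrt (E1norm m \<E> u) * sqrt (E1norm m \<E> v))"
proof -
  have "\<exists>c>0. \<forall>u\<in>D. \<forall>v\<in>D.
      \<bar>\<E> u v + inner_L2 m u v\<bar> \<le> c * sqrt (E1norm m \<E> u) * sqrt (E1norm m \<E> v)"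
    using sdf unfolding semi_dirichlet_form_def by blast
  then obtain c where c: "c > 0" "\<And>u v. u \<in> D \<Longrightarrow> v \<in> D \<Longrightarrow>
      \<bar>\<E> u v + inner_L2 m u v\<bar> \<le> c * sqrt (E1norm m \<E> u) * sqrt (E1norm m \<E> v)"
    by blast
  have "\<bar>\<E> u v\<bar> \<le> (c + 1) * (sqrt (E1norm m \<E> u) * sqrt (E1norm m \<E> v))"
    if "u \<in> D" "v \<in> D" for u v
  proof -
    have "\<bar>inner_L2 m u v\<bar> \<le> sqrt (inner_L2 m u u) * sqrt (inner_L2 m v v)"
      using that by (intro inner_L2_Cauchy_Schwarz D_L2)
    also have "\<dots> \<le> sqrt (E1norm m \<E> u) * sqrt (E1norm m \<E> v)"
      using that by (intro mult_mono real_sqrt_le_mono inner_le_E1norm)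
        (auto simp: inner_L2_self_nonneg E1norm_nonneg)
    finally show ?thesis
      using c(2)[OF that] by (simp add: algebra_simps)
  qed
  with c(1) show ?thesis by (intro that[of "c + 1"]) auto
qed

lemma form_scaled_sum:
  assumes "u \<in> D" "v \<in> D"
  shows "\<E> (\<lambda>x. a * u x + a * v x) (\<lambda>x. a * u x + a * v x) = a * a * (\<E> u u + \<E> u v + \<E> v u + \<E> v v)"
  using assms D_lincomb[OF assms, of a a] by (simp add: form_lincomb algebra_simps)

lemma inner_scaled_sum:
  assumes "u \<in> D" "v \<in> D"
  shows "inner_L2 m (\<lambda>x. a * u x + a * v x) (\<lambda>x. a * u x + a * v x) =
    a * a * (inner_L2 m u u + inner_L2 m u v + inner_L2 m v u + inner_L2 m v v)"
  using assms[THEN D_L2] D_lincomb[OF assms, of a a, THEN D_L2]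
  by (simp add: inner_L2_lincomb_left inner_L2_lincomb_right algebra_simps)

lemma inner_parallelogram:
  assumes "u \<in> D" "v \<in> D"
  shows "inner_L2 m (\<lambda>x. u x - v x) (\<lambda>x. u x - v x) =
    2 * inner_L2 m u u + 2 * inner_L2 m v v
      - 4 * inner_L2 m (\<lambda>x. 1/2 * u x + 1/2 * v x) (\<lambda>x. 1/2 * u x + 1/2 * v x)"
  using assms D_diff[OF assms] unfolding inner_scaled_sum[OF assms]
  by (simp add: inner_diff add_divide_distrib)

lemma E1norm_parallelogram:
  assumes "u \<in> D" "v \<in> D"
  shows "E1norm m \<E> (\<lambda>x. u x - v x) =
    2 * E1norm m \<E> u + 2 * E1norm m \<E> v - 4 * E1norm m \<E> (\<lambda>x. 1/2 * u x + 1/2 * v x)"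
  using assms D_diff[OF assms] inner_parallelogram[OF assms]
  unfolding E1norm_def form_scaled_sum[OF assms]
  by (simp add: form_diff add_divide_distrib)

lemma E1_complete:
  fixes s :: "nat \<Rightarrow> 'a \<Rightarrow> real"
  assumes "\<And>n. s n \<in> D"
    and "\<And>e. e > 0 \<Longrightarrow> \<exists>N. \<forall>n\<ge>N. \<forall>k\<ge>N. E1norm m \<E> (\<lambda>x. s n x - s k x) < e"
  obtains w where "w \<in> D" "(\<lambda>n. E1norm m \<E> (\<lambda>x. s n x - w x)) \<longlonglongrightarrow> 0"
proof -
  have "\<forall>s::nat \<Rightarrow> ('a \<Rightarrow> real). (\<forall>n. s n \<in> D) \<and>
          (\<forall>e>0. \<exists>N. \<forall>n\<ge>N. \<forall>k\<ge>N. E1norm m \<E> (\<lambda>x. s n x - s k x) < e) \<longrightarrow>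
          (\<exists>w\<in>D. (\<lambda>n. E1norm m \<E> (\<lambda>x. s n x - w x)) \<longlonglongrightarrow> 0)"
    using sdf unfolding semi_dirichlet_form_def by blast
  then show ?thesis using assms that by blast
qed

text \<open>The convex sets of counterexamples shrink, so almost-minimisers of the form norm in them
  are Cauchy by the parallelogram law; their limit vanishes in $L^2$, a contradiction.\<close>

lemma weakly_small:
  assumes q: "q \<in> D" and e: "e > 0"
  shows "\<exists>\<delta>>0. \<forall>w\<in>D. E1norm m \<E> w \<le> B \<longrightarrow> inner_L2 m w w \<le> \<delta> \<longrightarrow> \<bar>\<E> q w\<bar> < e"
proof (rule ccontr)
  assume contr: "\<not> ?thesis"
  define C where "C n = {w \<in> D. E1norm m \<E> w \<le> B \<and> inner_L2 m w w \<le> 1 / real (Suc n) \<and> e \<le> \<E> q w}"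
    for n
  have ne: "C n \<noteq> {}" for n
  proof -
    obtain w where w: "w \<in> D" "E1norm m \<E> w \<le> B" "inner_L2 m w w \<le> 1 / real (Suc n)"
        "e \<le> \<bar>\<E> q w\<bar>"
      using contr not_less by (metis of_nat_0_less_iff zero_less_Suc zero_less_divide_1_iff)
    define w' where "w' x = - 1 * w x" for x
    have w': "w' \<in> D" "\<E> q w' = - \<E> q w" "E1norm m \<E> w' = E1norm m \<E> w"
        "inner_L2 m w' w' = inner_L2 m w w"
      using D_scale[OF w(1), of "-1"] form_scale[OF w(1) q, of "-1"]
        form_scale[OF w(1) D_scale[OF w(1), of "-1"], of "-1"] form_scale[OF w(1) w(1), of "-1"]
      by (auto simp: w'_def[abs_def] E1norm_def inner_L2_def)
    have "w \<in> C n \<or> w' \<in> C n"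
      using w w' by (auto simp: C_def abs_if split: if_splits)
    then show ?thesis by blast
  qed
  have Cdec: "C k \<subseteq> C n" if "n \<le> k" for n k
  proof -
    have "1 / real (Suc k) \<le> 1 / real (Suc n)"
      using that by (intro divide_left_mono) auto
    then show ?thesis by (auto simp: C_def)
  qed
  have CD: "w \<in> D" if "w \<in> C n" for w n using that by (simp add: C_def)
  have mid: "(\<lambda>x. 1/2 * a x + 1/2 * b x) \<in> C n" if "a \<in> C n" "b \<in> C n" for a b n
  proof -
    have ab: "a \<in> D" "b \<in> D" using that CD by auto
    let ?c = "\<lambda>x. 1/2 * a x + 1/2 * b x"
    have "E1norm m \<E> ?c \<le> B"
      using E1norm_parallelogram[OF ab] E1norm_nonneg[OF D_diff[OF ab]] that by (auto simp: C_def)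
    moreover have "inner_L2 m ?c ?c \<le> 1 / real (Suc n)"
      using inner_parallelogram[OF ab] inner_L2_self_nonneg[of m "\<lambda>x. a x - b x"] that
      by (auto simp: C_def)
    moreover have "e \<le> \<E> q ?c"
      using form_lincomb(2)[OF ab q, of "1/2" "1/2"] that by (auto simp: C_def)
    ultimately show ?thesis using D_lincomb[OF ab, of "1/2" "1/2"] by (auto simp: C_def)
  qed
  define d where "d n = Inf (E1norm m \<E> ` C n)" for n
  have bdd: "bdd_below (E1norm m \<E> ` C n)" for n
    using E1norm_nonneg CD by (intro bdd_belowI[of _ 0]) auto
  have d_le: "d n \<le> E1norm m \<E> w" if "w \<in> C n" for n w
    unfolding d_def using bdd that by (intro cInf_lower) auto
  have d_inc: "incseq d"
    unfolding incseq_def d_def using Cdec ne bdd by (intro allI impI cInf_superset_mono) auto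
  have "d n \<le> B" for n
    using ne[of n] d_le[of _ n] by (force simp: C_def)
  then obtain L where L: "d \<longlonglongrightarrow> L" "\<And>n. d n \<le> L"
    using incseq_convergent[OF d_inc, of B] by metis
  have "\<exists>w\<in>C n. E1norm m \<E> w < d n + 1 / real (Suc n)" for n
    using cInf_lessD[of "E1norm m \<E> ` C n" "d n + 1 / real (Suc n)"] ne[of n] by (auto simp: d_def)
  then obtain z where z: "\<And>n. z n \<in> C n" "\<And>n. E1norm m \<E> (z n) < d n + 1 / real (Suc n)"
    by metis
  have zD: "z n \<in> D" for n using z(1) CD by blast
  have est: "E1norm m \<E> (\<lambda>x. z n x - z k x) \<le> 2 * (L - d N) * 2 + 4 / real (Suc N)"
    if "N \<le> n" "N \<le> k" for n k N
  proof -
    have "d N \<le> E1norm m \<E> (\<lambda>x. 1/2 * z n x + 1/2 * z k x)"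
      using mid[of "z n" N "z k"] z(1) Cdec that d_le by blast
    moreover have "1 / real (Suc n) \<le> 1 / real (Suc N)" "1 / real (Suc k) \<le> 1 / real (Suc N)"
      using that by (auto intro!: divide_left_mono)
    ultimately show ?thesis
      using E1norm_parallelogram[OF zD zD, of n k] z(2)[of n] z(2)[of k] L(2)[of n] L(2)[of k]
      by simp
  qed
  have lim0: "(\<lambda>N. 2 * (L - d N) * 2 + 4 / real (Suc N)) \<longlonglongrightarrow> 0"
  proof -
    have "(\<lambda>N. 2 * (L - d N) * 2 + 4 * (1 / real (Suc N))) \<longlonglongrightarrow> 2 * (L - L) * 2 + 4 * 0"
      by (intro tendsto_intros L(1) LIMSEQ_Suc[OF lim_1_over_n])
    then show ?thesis by simp
  qed
  have "\<exists>N. \<forall>n\<ge>N. \<forall>k\<ge>N. E1norm m \<E> (\<lambda>x. z n x - z k x) < r" if r: "r > 0" for r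
  proof -
    obtain N where N: "2 * (L - d N) * 2 + 4 / real (Suc N) < r"
      using order_tendstoD(2)[OF lim0 r] eventually_happens' sequentially_bot by blast
    show ?thesis
    proof (intro exI[of _ N] allI impI)
      fix n k assume "N \<le> n" "N \<le> k"
      from est[OF this] N show "E1norm m \<E> (\<lambda>x. z n x - z k x) < r" by (rule le_less_trans)
    qed
  qed
  then obtain y where y: "y \<in> D" "(\<lambda>n. E1norm m \<E> (\<lambda>x. z n x - y x)) \<longlonglongrightarrow> 0"
    using E1_complete[of z] zD by blast
  have "inner_L2 m y y \<le> 2 * (1 / real (Suc n)) + 2 * E1norm m \<E> (\<lambda>x. z n x - y x)" for n
  proof -
    have dn: "(\<lambda>x. z n x - y x) \<in> D" using zD y(1) D_diff by blast
    have "inner_L2 m y y \<le> 2 * inner_L2 m (z n) (z n)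
        + 2 * inner_L2 m (\<lambda>x. z n x - y x) (\<lambda>x. z n x - y x)"
      using inner_parallelogram[OF zD[of n] dn]
        inner_L2_self_nonneg[of m "\<lambda>x. 1/2 * z n x + 1/2 * (z n x - y x)"] by simp
    also have "\<dots> \<le> 2 * (1 / real (Suc n)) + 2 * E1norm m \<E> (\<lambda>x. z n x - y x)"
      using inner_le_E1norm[OF dn] z(1)[of n] by (simp add: C_def)
    finally show ?thesis .
  qed
  moreover have "(\<lambda>n. 2 * (1 / real (Suc n)) + 2 * E1norm m \<E> (\<lambda>x. z n x - y x)) \<longlonglongrightarrow> 2 * 0 + 2 * 0"
    by (intro tendsto_intros y(2) LIMSEQ_Suc[OF lim_1_over_n])
  ultimately have "inner_L2 m y y \<le> 0"
    using LIMSEQ_le_const by fastforce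
  then have "inner_L2 m y y = 0" using inner_L2_self_nonneg[of m y] by simp
  then have "AE x in m. y x * y x = 0"
    unfolding inner_L2_def
    using integral_nonneg_eq_0_iff_AE[of m "\<lambda>x. y x * y x"] L2_integrable_mult[OF D_L2 D_L2] y(1) by auto
  then have y0: "\<E> q y = 0" using form_AE_zero[OF y(1) q] by simp
  obtain c where c: "\<And>u v. u \<in> D \<Longrightarrow> v \<in> D \<Longrightarrow>
      \<bar>\<E> u v\<bar> \<le> c * (sqrt (E1norm m \<E> u) * sqrt (E1norm m \<E> v))"
    using form_bounded by metis
  have "e \<le> c * (sqrt (E1norm m \<E> q) * sqrt (E1norm m \<E> (\<lambda>x. z n x - y x)))" for n
  proof -
    have "e \<le> \<E> q (z n)" using z(1)[of n] by (simp add: C_def)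
    then show ?thesis
      using c[OF q D_diff[OF zD[of n] y(1)]] form_diff(2)[OF zD[of n] y(1) q] y0 by linarith
  qed
  moreover have "(\<lambda>n. c * (sqrt (E1norm m \<E> q) * sqrt (E1norm m \<E> (\<lambda>x. z n x - y x))))
      \<longlonglongrightarrow> c * (sqrt (E1norm m \<E> q) * sqrt 0)"
    by (intro tendsto_intros y(2))
  ultimately have "e \<le> 0"
    using LIMSEQ_le_const by fastforce
  with e show False by simp
qed

lemma co_resolvent_approximation:
  assumes G: "co_resolvent m D \<E> G" and q: "q \<in> D" and p: "p \<in> D"
  shows "((\<lambda>\<beta>. \<beta> * (inner_L2 m q p - inner_L2 m (\<lambda>x. \<beta> * G \<beta> p x) q)) \<longlongrightarrow> \<E> q p) at_top"
proof -
  obtain c where c: "c > 0" "\<And>u v. u \<in> D \<Longrightarrow> v \<in> D \<Longrightarrow>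
      \<bar>\<E> u v\<bar> \<le> c * (sqrt (E1norm m \<E> u) * sqrt (E1norm m \<E> v))"
    using form_bounded by metis
  define P where "P = E1norm m \<E> p"
  define B where "B = c\<^sup>2 * P"
  define w where "w \<beta> x = \<beta> * G \<beta> p x - p x" for \<beta> x
  have P0: "P \<ge> 0" using E1norm_nonneg[OF p] by (simp add: P_def)
  have GD: "G \<beta> p \<in> D" if "\<beta> > 0" for \<beta>
    using G that p D_L2 by (auto simp: co_resolvent_def)
  have Geq: "\<E> y (G \<beta> p) + \<beta> * inner_L2 m y (G \<beta> p) = inner_L2 m y p" if "\<beta> > 0" "y \<in> D" for \<beta> y
    using G that p D_L2 by (auto simp: co_resolvent_def)
  have wD: "w \<beta> \<in> D" if "\<beta> > 0" for \<beta>
    using D_diff[OF D_scale[OF GD[OF that], of \<beta>] p] by (simp add: w_def[abs_def])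
  have E_w: "\<E> y (w \<beta>) = - \<beta> * inner_L2 m y (w \<beta>) - \<E> y p" if "\<beta> > 0" "y \<in> D" for \<beta> y
  proof -
    have "\<E> y (w \<beta>) = \<beta> * \<E> y (G \<beta> p) - \<E> y p"
      using form_diff(2)[OF D_scale[OF GD[OF that(1)], of \<beta>] p that(2)]
        form_scale(2)[OF GD[OF that(1)] that(2), of \<beta>] by (simp add: w_def[abs_def])
    moreover have "inner_L2 m y (w \<beta>) = \<beta> * inner_L2 m y (G \<beta> p) - inner_L2 m y p"
      using inner_L2_lincomb_right[of "G \<beta> p" m p y \<beta> "-1"] that GD p D_L2
      by (simp add: w_def[abs_def])
    ultimately show ?thesis
      using Geq[OF that] by algebra
  qed
  have id1: "\<E> (w \<beta>) (w \<beta>) + \<beta> * inner_L2 m (w \<beta>) (w \<beta>) \<le> c * (sqrt (E1norm m \<E> (w \<beta>)) * sqrt P)"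
    if "\<beta> > 0" for \<beta>
    using E_w[OF that wD[OF that]] c(2)[OF wD[OF that] p] by (simp add: P_def)
  have bnd: "E1norm m \<E> (w \<beta>) \<le> B" if "\<beta> \<ge> 1" for \<beta>
  proof -
    define s where "s = sqrt (E1norm m \<E> (w \<beta>))"
    have b: "\<beta> > 0" using that by simp
    have s: "s \<ge> 0" "E1norm m \<E> (w \<beta>) = s\<^sup>2"
      using E1norm_nonneg[OF wD[OF b]] by (auto simp: s_def)
    have "1 * inner_L2 m (w \<beta>) (w \<beta>) \<le> \<beta> * inner_L2 m (w \<beta>) (w \<beta>)"
      using that inner_L2_self_nonneg by (intro mult_right_mono)
    then have "E1norm m \<E> (w \<beta>) \<le> c * (s * sqrt P)"
      using id1[OF b] by (simp add: E1norm_def s_def)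
    then have "s * s \<le> s * (c * sqrt P)"
      unfolding s(2) by (simp add: power2_eq_square mult_ac)
    then have "s \<le> c * sqrt P"
      using s(1) c(1) P0 by (cases "s = 0") (auto dest: mult_left_le_imp_le)
    then have "s\<^sup>2 \<le> (c * sqrt P)\<^sup>2" using s(1) by (intro power_mono)
    then show ?thesis using s(2) P0 by (simp add: B_def power_mult_distrib)
  qed
  have bnd2: "inner_L2 m (w \<beta>) (w \<beta>) \<le> c * (sqrt B * sqrt P) / \<beta>" if "\<beta> \<ge> 1" for \<beta>
  proof -
    have b: "\<beta> > 0" using that by simp
    have "\<beta> * inner_L2 m (w \<beta>) (w \<beta>) \<le> c * (sqrt (E1norm m \<E> (w \<beta>)) * sqrt P)"
      using id1[OF b] form_nonneg[OF wD[OF b]] by simp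
    also have "\<dots> \<le> c * (sqrt B * sqrt P)"
      using c(1) P0 bnd[OF that] by (intro mult_left_mono mult_right_mono real_sqrt_le_mono) auto
    finally show ?thesis using b by (simp add: field_simps)
  qed
  have "((\<lambda>\<beta>. \<E> q (w \<beta>)) \<longlongrightarrow> 0) at_top"
  proof (rule tendstoI)
    fix e :: real assume "e > 0"
    then obtain \<delta> where \<delta>: "\<delta> > 0"
      "\<And>y. y \<in> D \<Longrightarrow> E1norm m \<E> y \<le> B \<Longrightarrow> inner_L2 m y y \<le> \<delta> \<Longrightarrow> \<bar>\<E> q y\<bar> < e"
      using weakly_small[OF q, of e B] by metis
    have "((\<lambda>\<beta>. c * (sqrt B * sqrt P) / \<beta>) \<longlongrightarrow> 0) at_top"
      by (rule real_tendsto_divide_at_top[OF tendsto_const filterlim_ident])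
    then have "eventually (\<lambda>\<beta>. c * (sqrt B * sqrt P) / \<beta> < \<delta>) at_top"
      using \<delta>(1) by (rule order_tendstoD)
    then show "eventually (\<lambda>\<beta>. dist (\<E> q (w \<beta>)) 0 < e) at_top"
      using eventually_ge_at_top[of 1]
    proof eventually_elim
      case (elim \<beta>)
      then show ?case
        using \<delta>(2)[OF wD bnd, of \<beta>] bnd2[of \<beta>] by simp
    qed
  qed
  then have "((\<lambda>\<beta>. \<E> q (w \<beta>) + \<E> q p) \<longlongrightarrow> 0 + \<E> q p) at_top"
    by (intro tendsto_intros)
  moreover have "eventually (\<lambda>\<beta>. \<E> q (w \<beta>) + \<E> q p
      = \<beta> * (inner_L2 m q p - inner_L2 m (\<lambda>x. \<beta> * G \<beta> p x) q)) at_top"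
    using eventually_gt_at_top[of 0]
  proof eventually_elim
    case (elim \<beta>)
    have "inner_L2 m q (w \<beta>) = inner_L2 m (\<lambda>x. \<beta> * G \<beta> p x) q - inner_L2 m q p"
      using inner_diff(2)[OF D_scale[OF GD[OF elim], of \<beta>] p q]
      by (simp add: w_def[abs_def] inner_L2_commute[of m _ q])
    then show ?case using E_w[OF elim q] by algebra
  qed
  ultimately show ?thesis by (simp add: tendsto_cong)
qed

end

section \<open>Functions with compact support\<close>

lemma C0I:
  assumes "continuous_on UNIV f" "compact C" "\<And>x. x \<notin> C \<Longrightarrow> f x = 0"
  shows "f \<in> C0"
proof -
  have "supp f \<subseteq> C"
    unfolding supp_def using assms by (intro closure_minimal compact_imp_closed) auto
  then have "compact (supp f)"
    using compact_Int_closed[OF assms(2), of "supp f"] by (simp add: supp_def Int_absorb1)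
  with assms(1) show ?thesis by (simp add: C0_def)
qed

lemma C0_continuous: "f \<in> C0 \<Longrightarrow> continuous_on UNIV f"
  by (simp add: C0_def)

lemma C0_compact_supp: "f \<in> C0 \<Longrightarrow> compact (supp f)"
  by (simp add: C0_def)

lemma eq_0_off_supp: "x \<notin> supp f \<Longrightarrow> f x = 0"
  using closure_subset[of "{x. f x \<noteq> 0}"] by (auto simp: supp_def)

lemma C0_uniformly_small:
  fixes f :: "'a::metric_space \<Rightarrow> real"
  assumes f: "f \<in> C0" and e: "e > 0"
  obtains d where "d > 0" "\<And>x y. dist x y < d \<Longrightarrow> \<bar>f x - f y\<bar> < e"
proof -
  let ?\<G> = "(\<lambda>x. f -` ball (f x) (e/2)) ` supp f"
  have "open G" if "G \<in> ?\<G>" for G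
    using that C0_continuous[OF f] by (auto intro!: open_vimage)
  moreover have "supp f \<subseteq> \<Union>?\<G>" using e by auto
  ultimately obtain d where d: "d > 0" "\<And>x. x \<in> supp f \<Longrightarrow> \<exists>G\<in>?\<G>. ball x d \<subseteq> G"
    using Heine_Borel_lemma[OF C0_compact_supp[OF f]] by metis
  have near: "\<bar>f x - f y\<bar> < e" if xy: "x \<in> supp f" "dist x y < d" for x y
  proof -
    obtain z where "ball x d \<subseteq> f -` ball (f z) (e/2)" using d(2)[OF xy(1)] by blast
    moreover have "x \<in> ball x d" "y \<in> ball x d" using xy d(1) by auto
    ultimately have "dist (f z) (f x) < e/2" "dist (f z) (f y) < e/2" by (meson mem_ball subsetD vimageD)+
    then show ?thesis unfolding dist_real_def by linarith
  qed
  have "\<bar>f x - f y\<bar> < e" if "dist x y < d" for x y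
  proof (cases "x \<in> supp f \<or> y \<in> supp f")
    case True
    then show ?thesis using near[of x y] near[of y x] that by (auto simp: dist_commute abs_minus_commute)
  next
    case False
    then show ?thesis using e by (simp add: eq_0_off_supp)
  qed
  with d(1) show ?thesis by (rule that)
qed

lemma C0_lincomb:
  assumes "f \<in> C0" "g \<in> C0"
  shows "(\<lambda>x. a * f x + b * g x) \<in> C0"
  using assms[THEN C0_continuous] assms[THEN C0_compact_supp]
  by (intro C0I[of _ "supp f \<union> supp g"] continuous_intros compact_Un) (auto simp: eq_0_off_supp)

lemma C0_bounded:
  fixes f :: "'a::metric_space \<Rightarrow> real"
  assumes "f \<in> C0"
  obtains B where "B > 0" "\<And>x. \<bar>f x\<bar> \<le> B"
proof -
  have "bounded (f ` supp f)"
    using assms C0_continuous C0_compact_supp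
    by (intro compact_imp_bounded compact_continuous_image) (auto intro: continuous_on_subset)
  then obtain B where "B > 0" "\<And>x. x \<in> supp f \<Longrightarrow> \<bar>f x\<bar> \<le> B"
    by (force simp: bounded_pos)
  then have "\<bar>f x\<bar> \<le> B" for x by (cases "x \<in> supp f") (auto simp: eq_0_off_supp)
  with \<open>B > 0\<close> show ?thesis by (rule that)
qed

lemma compact_uniform_nhd:
  fixes X :: "'a::metric_space set"
  assumes "compact X" "open U" "X \<subseteq> U"
  obtains e where "e > 0" "\<And>x y. x \<in> X \<Longrightarrow> dist x y < e \<Longrightarrow> y \<in> U"
proof -
  obtain e where "e > 0" "\<And>x. x \<in> X \<Longrightarrow> ball x e \<subseteq> U"
    using Heine_Borel_lemma[OF assms(1), of "{U}"] assms(2,3) by auto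
  then show ?thesis using that by (metis mem_ball subsetD)
qed

lemma C0_cutoff:
  fixes X :: "'a::metric_space set"
  assumes X: "compact X" and U: "open U" "X \<subseteq> U" "compact (closure U)"
  obtains g e where "g \<in> C0" "supp g \<subseteq> U" "e > 0"
    "\<And>x y. x \<in> X \<Longrightarrow> dist x y < e \<Longrightarrow> g y = (3::real)"
proof (cases "X = {}")
  case True
  have "(\<lambda>_. 0) \<in> (C0 :: ('a \<Rightarrow> real) set)" by (rule C0I[of _ "{}"]) auto
  moreover have "supp (\<lambda>_::'a. 0) \<subseteq> U" by (simp add: supp_def)
  ultimately show ?thesis using that[of "\<lambda>_. 0" 1] True by auto
next
  case False
  obtain e where e: "e > 0" "\<And>x y. x \<in> X \<Longrightarrow> dist x y < e \<Longrightarrow> y \<in> U"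
    using compact_uniform_nhd[OF X U(1,2)] by blast
  define g where "g x = max 0 (min 3 (6 - 9 / e * infdist x X))" for x
  have cont: "continuous_on UNIV g"
    unfolding g_def by (intro continuous_intros)
  have clo: "closed {x. infdist x X \<le> 2/3 * e}"
    by (intro closed_Collect_le continuous_intros)
  have "{x. g x \<noteq> 0} \<subseteq> {x. infdist x X \<le> 2/3 * e}"
  proof clarify
    fix x assume "g x \<noteq> 0"
    then have "9 / e * infdist x X < 6" by (auto simp: g_def max_def min_def split: if_splits)
    then show "infdist x X \<le> 2/3 * e" using e(1) by (simp add: field_simps)
  qed
  then have s1: "supp g \<subseteq> {x. infdist x X \<le> 2/3 * e}"
    unfolding supp_def using clo by (rule closure_minimal)
  have s2: "{x. infdist x X \<le> 2/3 * e} \<subseteq> U"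
  proof clarify
    fix x assume "infdist x X \<le> 2/3 * e"
    then obtain a where "a \<in> X" "dist x a < e"
      using e(1) cInf_lessD[of "dist x ` X" e] False by (force simp: infdist_def)
    then show "x \<in> U" using e(2) by (simp add: dist_commute)
  qed
  have "supp g \<subseteq> closure U" using s1 s2 closure_subset by blast
  then have "compact (supp g)"
    using U(3) compact_Int_closed[of "closure U" "supp g"] by (simp add: supp_def Int_absorb1)
  then have "g \<in> C0" using cont by (simp add: C0_def)
  moreover have "g y = 3" if "x \<in> X" "dist x y < e/3" for x y
  proof -
    have "infdist y X \<le> e/3" using that by (intro infdist_le2[of x]) (auto simp: dist_commute)
    then have "9 / e * infdist y X \<le> 9 / e * (e/3)" using e(1) by (intro mult_left_mono) auto
    then have "9 / e * infdist y X \<le> 3" using e(1) by simp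
    then show ?thesis by (simp add: g_def)
  qed
  ultimately show ?thesis using that[of g "e/3"] s1 s2 e(1) by auto
qed

definition bcsupp :: "'a::metric_space set \<Rightarrow> ('a \<Rightarrow> real) \<Rightarrow> bool" where
  "bcsupp S g \<longleftrightarrow> g \<in> borel_measurable borel \<and> (\<exists>B. \<forall>x. \<bar>g x\<bar> \<le> B) \<and>
     (\<exists>C. compact C \<and> C \<subseteq> S \<and> (\<forall>x. x \<notin> C \<longrightarrow> g x = 0))"

lemma bcsupp_lincomb:
  assumes "bcsupp S f" "bcsupp S g"
  shows "bcsupp S (\<lambda>x. a * f x + b * g x)"
proof -
  obtain A B where AB: "\<And>x. \<bar>f x\<bar> \<le> A" "\<And>x. \<bar>g x\<bar> \<le> B"
    using assms unfolding bcsupp_def by blast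
  have "\<bar>a * f x + b * g x\<bar> \<le> \<bar>a\<bar> * A + \<bar>b\<bar> * B" for x
    using mult_left_mono[OF AB(1)[of x], of "\<bar>a\<bar>"] mult_left_mono[OF AB(2)[of x], of "\<bar>b\<bar>"]
      abs_triangle_ineq[of "a * f x" "b * g x"] by (simp add: abs_mult)
  then have "\<exists>B. \<forall>x. \<bar>a * f x + b * g x\<bar> \<le> B" by blast
  moreover obtain C C' where "compact C" "C \<subseteq> S" "\<forall>x. x \<notin> C \<longrightarrow> f x = 0"
      "compact C'" "C' \<subseteq> S" "\<forall>x. x \<notin> C' \<longrightarrow> g x = 0"
    using assms unfolding bcsupp_def by blast
  then have "\<exists>C. compact C \<and> C \<subseteq> S \<and> (\<forall>x. x \<notin> C \<longrightarrow> a * f x + b * g x = 0)"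
    by (intro exI[of _ "C \<union> C'"]) auto
  moreover have "(\<lambda>x. a * f x + b * g x) \<in> borel_measurable borel"
    using assms by (auto simp: bcsupp_def)
  ultimately show ?thesis by (simp add: bcsupp_def)
qed

lemma bcsupp_continuous:
  assumes g: "continuous_on UNIV g" and C: "compact C" "C \<subseteq> S" "\<And>x. x \<notin> C \<Longrightarrow> g x = 0"
  shows "bcsupp S g"
proof -
  have "bounded (g ` C)"
    using C g by (intro compact_imp_bounded compact_continuous_image) (auto intro: continuous_on_subset)
  then obtain B where B: "B > 0" "\<And>x. x \<in> C \<Longrightarrow> \<bar>g x\<bar> \<le> B"
    by (force simp: bounded_pos)
  then have "\<bar>g x\<bar> \<le> B" for x using C(3)[of x] by (cases "x \<in> C") auto
  moreover have "g \<in> borel_measurable borel" using g by (rule borel_measurable_continuous_onI)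
  ultimately show ?thesis using C unfolding bcsupp_def by blast
qed

lemma bcsupp_mult_indicator:
  assumes "bcsupp S g" "A \<in> sets borel"
  shows "bcsupp S (\<lambda>x. indicator A x * g x)"
proof -
  obtain B where B: "\<And>x. \<bar>g x\<bar> \<le> B" using assms unfolding bcsupp_def by blast
  then have "\<bar>indicator A x * g x\<bar> \<le> B" for x
    using order_trans[OF abs_ge_zero B[of x]] by (auto simp: indicator_def)
  moreover have "(\<lambda>x. indicator A x * g x) \<in> borel_measurable borel"
    using assms by (auto simp: bcsupp_def)
  ultimately show ?thesis using assms unfolding bcsupp_def by (metis mult_zero_right)
qed

lemma bcsupp_mono: "bcsupp S g \<Longrightarrow> S \<subseteq> S' \<Longrightarrow> bcsupp S' g"
  unfolding bcsupp_def by blast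

lemma bcsupp_integrable:
  assumes "bcsupp S g" "sets M = sets borel" "\<And>C. compact C \<Longrightarrow> C \<subseteq> S \<Longrightarrow> emeasure M C < \<infinity>"
  shows "integrable M g"
proof -
  obtain B where B: "\<And>x. \<bar>g x\<bar> \<le> B" using assms unfolding bcsupp_def by blast
  obtain C where C: "compact C" "C \<subseteq> S" "\<And>x. x \<notin> C \<Longrightarrow> g x = 0"
    using assms unfolding bcsupp_def by blast
  show ?thesis
  proof (rule integrableI_bounded_set[of C _ _ B])
    show "C \<in> sets M" using C(1) assms(2) by (simp add: borel_compact)
    show "g \<in> borel_measurable M"
      using assms(1,2) measurable_cong_sets[OF assms(2) refl] by (auto simp: bcsupp_def)
  qed (use B C assms(3) in auto)
qed

section \<open>Vague convergence off the diagonal\<close>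

definition ten :: "('a \<Rightarrow> real) \<Rightarrow> ('b \<Rightarrow> real) \<Rightarrow> 'a \<times> 'b \<Rightarrow> real" where
  "ten p q z = p (fst z) * q (snd z)"

lemma continuous_on_UNIV_fst:
  "continuous_on UNIV p \<Longrightarrow> continuous_on UNIV (\<lambda>z. p (fst z))"
  and continuous_on_UNIV_snd:
  "continuous_on UNIV q \<Longrightarrow> continuous_on UNIV (\<lambda>z. q (snd z))"
  by (rule continuous_on_compose2[OF _ continuous_on_fst[OF continuous_on_id]]
      continuous_on_compose2[OF _ continuous_on_snd[OF continuous_on_id]]; auto)+

lemma ten_continuous:
  assumes "continuous_on UNIV p" "continuous_on UNIV q"
  shows "continuous_on UNIV (ten p q)"
  unfolding ten_def[abs_def]
  by (intro continuous_on_mult continuous_on_UNIV_fst continuous_on_UNIV_snd assms)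

lemma swap_closure_symmetric:
  fixes S :: "('a::topological_space \<times> 'a) set"
  assumes "\<And>p. (snd p, fst p) \<in> S \<longleftrightarrow> p \<in> S"
  shows "(snd p, fst p) \<in> closure S \<longleftrightarrow> p \<in> closure S"
proof -
  have "prod.swap ` S \<subseteq> S" using assms by (auto simp: prod.swap_def)
  then have "prod.swap ` S \<subseteq> closure S" using closure_subset by blast
  moreover have "continuous_on (closure S) (prod.swap :: 'a \<times> 'a \<Rightarrow> _)"
    by (intro continuous_on_swap)
  ultimately have sub: "prod.swap ` closure S \<subseteq> closure S"
    by (intro image_closure_subset) auto
  then have "prod.swap p \<in> closure S \<longleftrightarrow> p \<in> closure S"
    by (metis image_subset_iff swap_swap)
  then show ?thesis by (simp add: prod.swap_def)
qed

lemma swap_frontier_symmetric: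
  fixes S :: "('a::topological_space \<times> 'a) set"
  assumes "\<And>p. (snd p, fst p) \<in> S \<longleftrightarrow> p \<in> S"
  shows "(snd p, fst p) \<in> frontier S \<longleftrightarrow> p \<in> frontier S"
proof -
  have "(snd p, fst p) \<in> - S \<longleftrightarrow> p \<in> - S" for p using assms by blast
  then show ?thesis
    using swap_closure_symmetric[OF assms, of p] swap_closure_symmetric[of "- S" p]
    unfolding frontier_closures by blast
qed

locale jump_form = sd_form m D \<E>
  for m :: "'a::{metric_space, second_countable_topology} measure" and D \<E> +
  fixes G :: "real \<Rightarrow> ('a \<Rightarrow> real) \<Rightarrow> ('a \<Rightarrow> real)"
    and J :: "('a \<times> 'a) measure" and K :: "'a measure"
    and \<sigma> :: "real \<Rightarrow> ('a \<times> 'a) measure"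
    and \<Omega> :: "nat \<Rightarrow> 'a set" and vs :: "nat \<Rightarrow> real"
  assumes reg: "regular_form m D \<E>"
    and cores: "co_resolvent m D \<E> G"
    and stand: "standing_assumption D J"
    and JK: "jumping_killing D \<E> J K"
    and sig: "co_resolvent_measures m G \<sigma>"
    and exh: "exhaustion_data J \<Omega> vs"
begin

abbreviation "V \<equiv> C0 \<inter> D"

lemma V_mult: "f \<in> V \<Longrightarrow> g \<in> V \<Longrightarrow> (\<lambda>x. f x * g x) \<in> V"
  using stand by (simp add: standing_assumption_def)

lemma V_lincomb: "f \<in> V \<Longrightarrow> g \<in> V \<Longrightarrow> (\<lambda>x. a * f x + b * g x) \<in> V"
  by (intro IntI C0_lincomb D_lincomb) auto

lemma V_scale: "f \<in> V \<Longrightarrow> (\<lambda>x. a * f x) \<in> V"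
  using V_lincomb[of f f a 0] by simp

lemma V_continuous: "f \<in> V \<Longrightarrow> continuous_on UNIV f"
  using C0_continuous by blast

lemma J_integrable: "f \<in> V \<Longrightarrow> g \<in> V \<Longrightarrow> integrable J (\<lambda>p. (f (snd p) - f (fst p)) * g (snd p))"
  using stand by (simp add: standing_assumption_def)

lemma exhaustion:
  shows "open (\<Omega> l)" "compact (closure (\<Omega> l))" "(\<Union>l. \<Omega> l) = UNIV" "vs l > 0" "vs \<longlonglongrightarrow> 0"
    "emeasure J (frontier {(x,y). x \<in> \<Omega> l \<and> y \<in> \<Omega> l \<and> dist x y \<ge> vs l}) = 0"
  using exh unfolding exhaustion_data_def by auto

lemma Omega_mono: "k \<le> l \<Longrightarrow> \<Omega> k \<subseteq> \<Omega> l"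
  using exh unfolding exhaustion_data_def by (metis lift_Suc_mono_le)

lemma compact_eventually_subset_Omega:
  assumes "compact X"
  shows "\<forall>\<^sub>F l in sequentially. X \<subseteq> \<Omega> l"
proof -
  obtain I where I: "finite I" "X \<subseteq> (\<Union>l\<in>I. \<Omega> l)"
    using compactE_image[OF assms, of UNIV \<Omega>] exhaustion(1,3) by (metis UNIV_I subset_UNIV)
  have "X \<subseteq> \<Omega> l" if "l \<ge> Max (insert 0 I)" for l
  proof -
    have "\<Omega> k \<subseteq> \<Omega> l" if "k \<in> I" for k
      using that \<open>l \<ge> Max (insert 0 I)\<close> I(1) by (intro Omega_mono) (simp add: Max_ge)
    then show ?thesis using I(2) by blast
  qed
  then show ?thesis unfolding eventually_sequentially by blast
qed

lemma D_positive_part_shift: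
  assumes "f \<in> V" and "c > 0"
  shows "(\<lambda>x. max (f x - c) 0) \<in> D"
proof -
  obtain B where B: "B > 0" "\<And>x. \<bar>f x\<bar> \<le> B" using assms(1) C0_bounded by blast
  have trunc: "(\<lambda>x. min (max (f x) 0) b) \<in> D" if "b > 0" for b
  proof -
    have "(\<lambda>x. b * min (max (1 / b * f x) 0) 1) \<in> D"
      using assms(1) by (intro D_scale D_unit_truncation) blast
    moreover have "b * min (max (1 / b * y) 0) 1 = min (max y 0) b" for y
      using that by (auto simp: min_def max_def field_simps)
    ultimately show ?thesis by simp
  qed
  have "(\<lambda>x. min (max (f x) 0) (B + c) - min (max (f x) 0) c) \<in> D"
    using B(1) assms(2) by (intro D_diff trunc) auto
  moreover have "min (max (f x) 0) (B + c) - min (max (f x) 0) c = max (f x - c) 0" for x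
    using B(2)[of x] assms(2) by (auto simp: min_def max_def)
  ultimately show ?thesis by simp
qed

lemma bump:
  assumes "compact X" "open U" "X \<subseteq> U"
  obtains h e where "h \<in> V" "\<And>x. 0 \<le> h x" "\<And>x. h x \<le> 1" "supp h \<subseteq> U" "e > 0"
    "\<And>x y. x \<in> X \<Longrightarrow> dist x y < e \<Longrightarrow> h y = 1"
proof -
  obtain l where l: "X \<subseteq> \<Omega> l"
    using eventually_happens'[OF _ compact_eventually_subset_Omega[OF assms(1)]] by auto
  have "compact (closure (U \<inter> \<Omega> l))"
    using compact_Int_closed[OF exhaustion(2)[of l], of "closure (U \<inter> \<Omega> l)"]
    by (simp add: Int_absorb1 closure_mono)
  then obtain g e where g: "g \<in> C0" "supp g \<subseteq> U \<inter> \<Omega> l" "e > 0"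
      "\<And>x y. x \<in> X \<Longrightarrow> dist x y < e \<Longrightarrow> g y = 3"
    using C0_cutoff[OF assms(1), of "U \<inter> \<Omega> l"] assms(2,3) l exhaustion(1) by (metis le_inf_iff open_Int)
  have "\<forall>g\<in>C0. \<forall>e>0. \<exists>f\<in>V. \<forall>x. \<bar>g x - f x\<bar> < e"
    using reg unfolding regular_form_def by blast
  then obtain f where f: "f \<in> V" "\<And>x. \<bar>g x - f x\<bar> < 1/2"
    using g(1) by (metis half_gt_zero zero_less_one)
  define h where "h x = min (max (max (f x - 1/2) 0) 0) 1" for x
  have hD: "h \<in> D"
    unfolding h_def by (intro D_unit_truncation D_positive_part_shift f(1)) simp
  have h0: "h x = 0" if "g x = 0" for x
    using f(2)[of x] that by (auto simp: h_def)
  have "continuous_on UNIV h"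
    unfolding h_def using V_continuous[OF f(1)] by (intro continuous_intros)
  then have hC: "h \<in> C0"
    using C0_compact_supp[OF g(1)] h0 eq_0_off_supp by (intro C0I[of _ "supp g"]) auto
  have "{x. h x \<noteq> 0} \<subseteq> {x. g x \<noteq> 0}" using h0 by auto
  then have "supp h \<subseteq> supp g" unfolding supp_def by (rule closure_mono)
  then have "supp h \<subseteq> U" using g(2) by blast
  moreover have "h y = 1" if "x \<in> X" "dist x y < e" for x y
  proof -
    have "f y > 2" using g(4)[OF that] f(2)[of y] by linarith
    then show ?thesis by (simp add: h_def)
  qed
  ultimately show ?thesis
    using that[of h e] hD hC g(3) by (auto simp: h_def)
qed

lemma V_zero: "(\<lambda>_. 0) \<in> V"
  using bump[of "{}" UNIV] V_scale[of _ 0] by auto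

text \<open>The factor 2 and the exchange of coordinates make \<open>N\<close> the vague limit of \<open>T \<beta>\<close> off the
  diagonal.\<close>

definition T :: "real \<Rightarrow> ('a \<times> 'a \<Rightarrow> real) \<Rightarrow> real" where
  "T \<beta> g = \<beta> * (\<integral>z. g z \<partial>\<sigma> \<beta>)"

definition N :: "('a \<times> 'a \<Rightarrow> real) \<Rightarrow> real" where
  "N g = 2 * (\<integral>z. g (snd z, fst z) \<partial>J)"

lemma sigma_integrable:
  assumes "bcsupp UNIV g" "\<beta> > 0"
  shows "integrable (\<sigma> \<beta>) g"
  using assms sig
  by (intro bcsupp_integrable[OF assms(1)]) (auto simp: co_resolvent_measures_def radon_measure_def)

lemma J_sets: "sets J = sets borel"
  using JK by (simp add: jumping_killing_def radon_measure_offdiag_def)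

lemma J_diag: "AE z in J. fst z \<noteq> snd z"
proof -
  have "closed (diag :: ('a \<times> 'a) set)"
    unfolding diag_def by (intro closed_Collect_eq continuous_intros)
  then have "diag \<in> null_sets J"
    using JK J_sets by (auto simp: null_sets_def jumping_killing_def radon_measure_offdiag_def)
  then have "AE z in J. z \<notin> diag" by (rule AE_not_in)
  then show ?thesis by (simp add: diag_def)
qed

lemma swap_measurable: "(\<lambda>z. (snd z, fst z)) \<in> borel_measurable (borel :: ('a \<times> 'a) measure)"
  by (intro borel_measurable_continuous_onI continuous_intros)

lemma bcsupp_swap:
  assumes "bcsupp (- diag) g"
  shows "bcsupp (- diag) (\<lambda>z::'a \<times> 'a. g (snd z, fst z))"
proof -
  obtain C where C: "compact C" "C \<subseteq> - diag" "\<forall>x. x \<notin> C \<longrightarrow> g x = 0"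
    using assms unfolding bcsupp_def by blast
  have "compact (prod.swap ` C)"
    using C(1) by (intro compact_continuous_image continuous_on_swap)
  moreover have "prod.swap ` C \<subseteq> - diag" using C(2) by (auto simp: diag_def)
  moreover have "g (snd z, fst z) = 0" if "z \<notin> prod.swap ` C" for z
    using C(3) that by (metis fst_swap image_eqI prod.collapse snd_swap swap_simp)
  moreover have "(\<lambda>z. g (snd z, fst z)) \<in> borel_measurable borel"
    using measurable_compose[OF swap_measurable] assms by (auto simp: bcsupp_def)
  ultimately show ?thesis using assms unfolding bcsupp_def by blast
qed

lemma N_integrable:
  assumes "bcsupp (- diag) g"
  shows "integrable J (\<lambda>z. g (snd z, fst z))"
  using bcsupp_integrable[OF bcsupp_swap[OF assms] J_sets] JK
  by (auto simp: jumping_killing_def radon_measure_offdiag_def disjoint_eq_subset_Compl)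

lemma T_lincomb:
  assumes "bcsupp UNIV f" "bcsupp UNIV g" "\<beta> > 0"
  shows "T \<beta> (\<lambda>z. a * f z + b * g z) = a * T \<beta> f + b * T \<beta> g"
  using sigma_integrable[OF assms(1,3)] sigma_integrable[OF assms(2,3)]
  by (simp add: T_def algebra_simps)

lemma T_mono:
  assumes "bcsupp UNIV f" "bcsupp UNIV g" "\<beta> > 0" "\<And>z. f z \<le> g z"
  shows "T \<beta> f \<le> T \<beta> g"
  unfolding T_def using assms by (intro mult_left_mono integral_mono sigma_integrable) auto

lemma N_lincomb:
  assumes "bcsupp (- diag) f" "bcsupp (- diag) g"
  shows "N (\<lambda>z. a * f z + b * g z) = a * N f + b * N g"
  using N_integrable[OF assms(1)] N_integrable[OF assms(2)]
  by (simp add: N_def algebra_simps)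

lemma N_mono:
  assumes "bcsupp (- diag) f" "bcsupp (- diag) g" "\<And>z. f z \<le> g z"
  shows "N f \<le> N g"
  unfolding N_def using assms by (intro mult_left_mono integral_mono N_integrable) auto

lemma ten_bcsupp:
  assumes "p \<in> C0" "q \<in> C0"
  shows "bcsupp UNIV (ten p q)"
  using assms by (intro bcsupp_continuous[of _ "supp p \<times> supp q"] ten_continuous compact_Times)
    (auto simp: ten_def C0_continuous C0_compact_supp intro: eq_0_off_supp ccontr)

lemma form_limit:
  assumes "p \<in> V" "q \<in> V"
  shows "((\<lambda>\<beta>. \<beta> * inner_L2 m q p - T \<beta> (ten p q)) \<longlongrightarrow> \<E> q p) at_top"
proof -
  have "((\<lambda>\<beta>. \<beta> * (inner_L2 m q p - inner_L2 m (\<lambda>x. \<beta> * G \<beta> p x) q)) \<longlongrightarrow> \<E> q p) at_top"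
    using co_resolvent_approximation[OF cores, of q p] assms by auto
  moreover have "\<forall>\<^sub>F \<beta> in at_top. \<beta> * (inner_L2 m q p - inner_L2 m (\<lambda>x. \<beta> * G \<beta> p x) q)
      = \<beta> * inner_L2 m q p - T \<beta> (ten p q)"
    using eventually_gt_at_top[of 0]
  proof eventually_elim
    case (elim \<beta>)
    have "inner_L2 m (\<lambda>x. \<beta> * G \<beta> p x) q = (\<integral>z. p (fst z) * q (snd z) \<partial>\<sigma> \<beta>)"
      using sig elim assms by (auto simp: co_resolvent_measures_def)
    then show ?case by (simp add: T_def ten_def right_diff_distrib)
  qed
  ultimately show ?thesis by (simp add: tendsto_cong)
qed

definition vague :: "('a \<times> 'a \<Rightarrow> real) \<Rightarrow> bool" where
  "vague g \<longleftrightarrow> bcsupp (- diag) g \<and> ((\<lambda>\<beta>. T \<beta> g) \<longlongrightarrow> N g) at_top"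

lemma vague_bcsupp: "vague g \<Longrightarrow> bcsupp (- diag) g" "vague g \<Longrightarrow> bcsupp UNIV g"
  unfolding vague_def using bcsupp_mono by blast+

lemma vague_lincomb:
  assumes "vague f" "vague g"
  shows "vague (\<lambda>z. a * f z + b * g z)"
proof -
  have "((\<lambda>\<beta>. a * T \<beta> f + b * T \<beta> g) \<longlongrightarrow> N (\<lambda>z. a * f z + b * g z)) at_top"
    unfolding N_lincomb[OF assms[THEN vague_bcsupp(1)]]
    using assms by (intro tendsto_intros) (auto simp: vague_def)
  moreover have "\<forall>\<^sub>F \<beta> in at_top. a * T \<beta> f + b * T \<beta> g = T \<beta> (\<lambda>z. a * f z + b * g z)"
    using eventually_gt_at_top[of 0]
    by eventually_elim (simp add: T_lincomb[OF assms[THEN vague_bcsupp(2)]])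
  ultimately have "((\<lambda>\<beta>. T \<beta> (\<lambda>z. a * f z + b * g z)) \<longlongrightarrow> N (\<lambda>z. a * f z + b * g z)) at_top"
    by (simp add: tendsto_cong)
  then show ?thesis
    unfolding vague_def using bcsupp_lincomb[OF assms[THEN vague_bcsupp(1)]] by blast
qed

lemma vague_squeeze:
  assumes g: "bcsupp (- diag) g"
    and approx: "\<And>e. e > 0 \<Longrightarrow> \<exists>g' H. vague g' \<and> vague H \<and> (\<forall>z. \<bar>g z - g' z\<bar> \<le> H z) \<and> N H < e"
  shows "vague g"
proof -
  have "((\<lambda>\<beta>. T \<beta> g) \<longlongrightarrow> N g) at_top"
  proof (rule tendstoI)
    fix e :: real assume "e > 0"
    then obtain g' H where gH: "vague g'" "vague H" "\<And>z. \<bar>g z - g' z\<bar> \<le> H z" "N H < e/3"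
      using approx[of "e/3"] by auto
    have gU: "bcsupp UNIV g" using bcsupp_mono[OF g] by simp
    note b = vague_bcsupp[OF gH(1)] vague_bcsupp[OF gH(2)]
    have pt: "1 * g' z + (-1) * H z \<le> g z" "g z \<le> 1 * g' z + 1 * H z" for z
      using gH(3)[of z] by auto
    have Nb: "\<bar>N g - N g'\<bar> \<le> N H"
      using N_mono[OF bcsupp_lincomb[OF b(1,3)] g pt(1)] N_mono[OF g bcsupp_lincomb[OF b(1,3)] pt(2)]
      unfolding N_lincomb[OF b(1,3)] by auto
    have Tb: "\<bar>T \<beta> g - T \<beta> g'\<bar> \<le> T \<beta> H" if "\<beta> > 0" for \<beta>
      using T_mono[OF bcsupp_lincomb[OF b(2,4)] gU that pt(1)]
        T_mono[OF gU bcsupp_lincomb[OF b(2,4)] that pt(2)]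
      unfolding T_lincomb[OF b(2,4) that] by auto
    have "\<forall>\<^sub>F \<beta> in at_top. T \<beta> H < e/3"
      using gH(2,4) order_tendstoD(2) unfolding vague_def by blast
    moreover have "\<forall>\<^sub>F \<beta> in at_top. dist (T \<beta> g') (N g') < e/3"
      using gH(1) \<open>e > 0\<close> unfolding vague_def by (auto dest: tendstoD[of _ _ _ "e/3"])
    ultimately show "\<forall>\<^sub>F \<beta> in at_top. dist (T \<beta> g) (N g) < e"
      using eventually_gt_at_top[of 0]
    proof eventually_elim
      case (elim \<beta>)
      then show ?case using Nb Tb[of \<beta>] gH(4) unfolding dist_real_def by linarith
    qed
  qed
  with g show ?thesis by (simp add: vague_def)
qed

inductive_set Ten :: "('a \<times> 'a \<Rightarrow> real) set" where
  ten: "p \<in> V \<Longrightarrow> q \<in> V \<Longrightarrow> supp p \<inter> supp q = {} \<Longrightarrow> ten p q \<in> Ten"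
| add: "f \<in> Ten \<Longrightarrow> g \<in> Ten \<Longrightarrow> (\<lambda>z. f z + g z) \<in> Ten"

inductive_set Alg :: "('a \<times> 'a \<Rightarrow> real) set" where
  const: "(\<lambda>_. c) \<in> Alg"
| fst: "a \<in> V \<Longrightarrow> (\<lambda>z. a (fst z)) \<in> Alg"
| snd: "a \<in> V \<Longrightarrow> (\<lambda>z. a (snd z)) \<in> Alg"
| add: "f \<in> Alg \<Longrightarrow> g \<in> Alg \<Longrightarrow> (\<lambda>z. f z + g z) \<in> Alg"
| mult: "f \<in> Alg \<Longrightarrow> g \<in> Alg \<Longrightarrow> (\<lambda>z. f z * g z) \<in> Alg"

lemma supp_mult_subset: "supp (\<lambda>x. a x * p x) \<subseteq> supp p"
  unfolding supp_def by (intro closure_mono) auto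

lemma Ten_ten_scaled: "p \<in> V \<Longrightarrow> q \<in> V \<Longrightarrow> supp p \<inter> supp q = {} \<Longrightarrow> a \<in> V
    \<Longrightarrow> (\<lambda>z. a (fst z) * ten p q z) \<in> Ten \<and> (\<lambda>z. a (snd z) * ten p q z) \<in> Ten"
proof -
  assume *: "p \<in> V" "q \<in> V" "supp p \<inter> supp q = {}" "a \<in> V"
  have "ten (\<lambda>x. a x * p x) q \<in> Ten" "ten p (\<lambda>x. a x * q x) \<in> Ten"
    using * supp_mult_subset[of a p] supp_mult_subset[of a q] by (auto intro!: Ten.ten V_mult)
  then show ?thesis by (simp add: ten_def[abs_def] mult_ac)
qed

lemma Alg_mult_Ten: "f \<in> Alg \<Longrightarrow> g \<in> Ten \<Longrightarrow> (\<lambda>z. f z * g z) \<in> Ten"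
proof (induction arbitrary: g rule: Alg.induct)
  case (const c)
  show ?case using const
  proof (induction rule: Ten.induct)
    case (ten p q)
    have "ten (\<lambda>x. c * p x) q \<in> Ten"
      using ten supp_mult_subset[of "\<lambda>_. c" p] by (auto intro!: Ten.ten V_scale)
    then show ?case by (simp add: ten_def[abs_def] mult_ac)
  next
    case (add f g)
    then show ?case using Ten.add[OF add.IH] by (simp add: distrib_left)
  qed
next
  case (fst a)
  from fst(2,1) show ?case
  proof (induction rule: Ten.induct)
    case (add f g)
    then show ?case using Ten.add[OF add.IH] by (simp add: distrib_left)
  qed (use Ten_ten_scaled in blast)
next
  case (snd a)
  from snd(2,1) show ?case
  proof (induction rule: Ten.induct)
    case (add f g)
    then show ?case using Ten.add[OF add.IH] by (simp add: distrib_left)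
  qed (use Ten_ten_scaled in blast)
next
  case (add f f')
  then show ?case using Ten.add[OF add.IH(1)[OF add.prems] add.IH(2)[OF add.prems]] by (simp add: distrib_right)
next
  case (mult f f')
  then show ?case using mult.IH(1)[OF mult.IH(2)[OF mult.prems]] by (simp add: mult.assoc)
qed

lemma Ten_continuous: "g \<in> Ten \<Longrightarrow> continuous_on UNIV g"
  by (induction rule: Ten.induct) (auto intro!: continuous_on_add intro: ten_continuous V_continuous)

lemma Alg_continuous: "g \<in> Alg \<Longrightarrow> continuous_on UNIV g"
  by (induction rule: Alg.induct)
    (auto intro!: continuous_on_add continuous_on_mult
      intro: continuous_on_UNIV_fst continuous_on_UNIV_snd V_continuous)

lemma Ten_vague: "g \<in> Ten \<Longrightarrow> vague g"
proof (induction rule: Ten.induct)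
  case (ten p q)
  have off: "supp p \<times> supp q \<subseteq> - diag" using ten(3) by (auto simp: diag_def)
  have b: "bcsupp (- diag) (ten p q)"
    using ten(1,2) off
    by (intro bcsupp_continuous[of _ "supp p \<times> supp q"] ten_continuous compact_Times)
      (auto simp: ten_def C0_continuous C0_compact_supp intro: eq_0_off_supp ccontr)
  have pq: "q x * p x = 0" for x
    using ten(3) eq_0_off_supp[of x p] eq_0_off_supp[of x q] by auto
  have "open (- supp q)" "supp p \<subseteq> - supp q" "\<forall>x\<in>- supp q. q x = 0"
    using ten(3) eq_0_off_supp by (auto simp: supp_def)
  then have "\<E> q p = (\<integral>z. 2 * (q (snd z) - q (fst z)) * p (snd z) \<partial>J) + (\<integral>x. q x * p x \<partial>K)"
    using JK ten(1,2) unfolding jumping_killing_def by blast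
  also have "\<dots> = (\<integral>z. - 2 * ten p q (snd z, fst z) \<partial>J)"
  proof -
    have eq: "2 * (q (snd z) - q (fst z)) * p (snd z) = - 2 * ten p q (snd z, fst z)" for z
      using pq[of "snd z"] by (auto simp: ten_def)
    show ?thesis unfolding eq pq by simp
  qed
  also have "\<dots> = - N (ten p q)"
    by (simp add: N_def)
  finally have "\<E> q p = - N (ten p q)" .
  moreover have "inner_L2 m q p = 0" by (simp add: inner_L2_def pq)
  ultimately have "((\<lambda>\<beta>. - T \<beta> (ten p q)) \<longlongrightarrow> - N (ten p q)) at_top"
    using form_limit[OF ten(1,2)] by simp
  then have "((\<lambda>\<beta>. T \<beta> (ten p q)) \<longlongrightarrow> N (ten p q)) at_top"
    by (rule tendsto_minus_cancel)
  with b show ?case by (simp add: vague_def)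
next
  case (add f g)
  then show ?case using vague_lincomb[of f g 1 1] by simp
qed

lemma Ten_dominating:
  assumes "compact C" "C \<subseteq> - diag"
  obtains H where "H \<in> Ten" "\<And>z. 0 \<le> H z" "\<And>z. z \<in> C \<Longrightarrow> 1 \<le> H z"
proof -
  have "\<exists>H. H \<in> Ten \<and> (\<forall>z'. 0 \<le> H z') \<and> 1 < H z" if z: "z \<in> C" for z
  proof -
    have "fst z \<noteq> snd z" using z assms(2) by (auto simp: diag_def)
    then obtain A B where AB: "open A" "open B" "fst z \<in> A" "snd z \<in> B" "A \<inter> B = {}"
      using hausdorff[of "fst z" "snd z"] by blast
    have sub: "{fst z} \<subseteq> A" "{snd z} \<subseteq> B" using AB(3,4) by auto
    obtain p e where p: "p \<in> V" "\<And>x. 0 \<le> p x" "\<And>x. p x \<le> 1" "supp p \<subseteq> A" "e > 0"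
        "\<And>x y. x \<in> {fst z} \<Longrightarrow> dist x y < e \<Longrightarrow> p y = 1"
      by (rule bump[OF compact_sing AB(1) sub(1)]) (rule that)
    obtain q e' where q: "q \<in> V" "\<And>x. 0 \<le> q x" "\<And>x. q x \<le> 1" "supp q \<subseteq> B" "e' > 0"
        "\<And>x y. x \<in> {snd z} \<Longrightarrow> dist x y < e' \<Longrightarrow> q y = 1"
      by (rule bump[OF compact_sing AB(2) sub(2)]) (rule that)
    have "ten p q \<in> Ten" using p(1,4) q(1,4) AB(5) by (intro Ten.ten) auto
    then have "(\<lambda>z. 2 * ten p q z) \<in> Ten" by (rule Alg_mult_Ten[OF Alg.const])
    moreover have "1 < 2 * ten p q z" using p(5,6) q(5,6) by (simp add: ten_def)
    moreover have "0 \<le> 2 * ten p q z'" for z' using p(2) q(2) by (simp add: ten_def)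
    ultimately show ?thesis by blast
  qed
  then obtain H where H: "\<And>z. z \<in> C \<Longrightarrow> H z \<in> Ten" "\<And>z z'. z \<in> C \<Longrightarrow> 0 \<le> H z z'"
      "\<And>z. z \<in> C \<Longrightarrow> 1 < H z z"
    by metis
  have "open {z'. 1 < H z z'}" if "z \<in> C" for z
    using H(1)[OF that] by (intro open_Collect_less continuous_intros Ten_continuous)
  moreover have "C \<subseteq> (\<Union>z\<in>C. {z'. 1 < H z z'})" using H(3) by blast
  ultimately obtain I where I: "I \<subseteq> C" "finite I" "C \<subseteq> (\<Union>z\<in>I. {z'. 1 < H z z'})"
    using compactE_image[OF assms(1), of C "\<lambda>z. {z'. 1 < H z z'}"] by metis
  have zero: "(\<lambda>z. 0) \<in> Ten"
    using Ten.ten[OF V_zero V_zero] by (simp add: ten_def[abs_def] supp_def)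
  have "(\<lambda>z'. \<Sum>z\<in>I. H z z') \<in> Ten"
    using I(2,1)
  proof (induction rule: finite_induct)
    case empty
    then show ?case using zero by simp
  next
    case (insert x F)
    then show ?case using Ten.add[of "H x" "\<lambda>z'. \<Sum>z\<in>F. H z z'"] H(1) by simp
  qed
  moreover have "0 \<le> (\<Sum>z\<in>I. H z z')" for z' by (intro sum_nonneg H(2) subsetD[OF I(1)])
  moreover have "1 \<le> (\<Sum>z\<in>I. H z z')" if z': "z' \<in> C" for z'
  proof -
    obtain z where "z \<in> I" "1 < H z z'" using I(3) z' by blast
    have "H z z' \<le> (\<Sum>z\<in>I. H z z')"
      using \<open>z \<in> I\<close> I(2) by (intro member_le_sum H(2) subsetD[OF I(1)]) auto
    with \<open>1 < H z z'\<close> show ?thesis by simp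
  qed
  ultimately show ?thesis by (rule that)
qed

lemma vague_continuous:
  assumes g: "continuous_on UNIV g" and C: "compact C" "C \<subseteq> - diag" "\<And>z. z \<notin> C \<Longrightarrow> g z = 0"
  shows "vague g"
proof (rule vague_squeeze)
  show "bcsupp (- diag) g" using g C by (rule bcsupp_continuous)
next
  fix e :: real assume e: "e > 0"
  obtain H where H: "H \<in> Ten" "\<And>z. 0 \<le> H z" "\<And>z. z \<in> C \<Longrightarrow> 1 \<le> H z"
    using Ten_dominating[OF C(1,2)] by blast
  obtain C' where C': "compact C'" "\<And>z. z \<notin> C' \<Longrightarrow> H z = 0"
    using vague_bcsupp(2)[OF Ten_vague[OF H(1)]] unfolding bcsupp_def by blast
  define k where "k z = g z / max (H z) 1" for z
  have k: "continuous_on UNIV k"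
    unfolding k_def using g Ten_continuous[OF H(1)]
    by (intro continuous_intros) (auto simp: max_def)
  have kH: "g z = k z * H z" for z
    using C(3)[of z] H(3)[of z] by (cases "z \<in> C") (auto simp: k_def max_def)
  define d where "d = e / (2 * (N H + 1))"
  have NH: "0 \<le> N H" unfolding N_def using H(2) by simp
  then have d: "d > 0" using e by (simp add: d_def)
  have "\<exists>F. F \<in> Alg \<and> (\<forall>z\<in>C'. \<bar>k z - F z\<bar> < d)"
  proof (rule Stone_Weierstrass_HOL[OF C'(1)])
    fix x y :: "'a \<times> 'a" assume "x \<in> C' \<and> y \<in> C' \<and> x \<noteq> y"
    then consider "fst x \<noteq> fst y" | "snd x \<noteq> snd y" by (metis prod_eqI)
    then show "\<exists>f. f \<in> Alg \<and> f x \<noteq> f y"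
    proof cases
      case 1
      then have sub: "{fst x} \<subseteq> - {fst y}" by simp
      obtain h r where h: "h \<in> V" "\<And>x. 0 \<le> h x" "\<And>x. h x \<le> 1" "supp h \<subseteq> - {fst y}" "r > 0"
          "\<And>a b. a \<in> {fst x} \<Longrightarrow> dist a b < r \<Longrightarrow> h b = 1"
        by (rule bump[OF compact_sing open_Compl[OF closed_singleton] sub]) (rule that)
      then have "h (fst x) = 1" "h (fst y) = 0" using eq_0_off_supp[of "fst y" h] by auto
      then show ?thesis using Alg.fst[OF \<open>h \<in> V\<close>] by (intro exI[of _ "\<lambda>z. h (fst z)"]) simp
    next
      case 2
      then have sub: "{snd x} \<subseteq> - {snd y}" by simp
      obtain h r where h: "h \<in> V" "\<And>x. 0 \<le> h x" "\<And>x. h x \<le> 1" "supp h \<subseteq> - {snd y}" "r > 0"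
          "\<And>a b. a \<in> {snd x} \<Longrightarrow> dist a b < r \<Longrightarrow> h b = 1"
        by (rule bump[OF compact_sing open_Compl[OF closed_singleton] sub]) (rule that)
      then have "h (snd x) = 1" "h (snd y) = 0" using eq_0_off_supp[of "snd y" h] by auto
      then show ?thesis using Alg.snd[OF \<open>h \<in> V\<close>] by (intro exI[of _ "\<lambda>z. h (snd z)"]) simp
    qed
  qed (use k d Alg.intros in \<open>auto intro: continuous_on_subset continuous_on_subset[OF Alg_continuous]\<close>)
  then obtain F where F: "F \<in> Alg" "\<And>z. z \<in> C' \<Longrightarrow> \<bar>k z - F z\<bar> < d" by blast
  have dH: "(\<lambda>z. d * H z) \<in> Ten" using Alg_mult_Ten[OF Alg.const H(1)] .
  have "\<bar>g z - F z * H z\<bar> \<le> d * H z" for z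
  proof (cases "z \<in> C'")
    case True
    have "\<bar>g z - F z * H z\<bar> = \<bar>k z - F z\<bar> * H z"
      using H(2)[of z] unfolding kH by (simp add: left_diff_distrib[symmetric] abs_mult)
    then show ?thesis using F(2)[OF True] H(2)[of z] by (simp add: mult_right_mono)
  qed (simp add: C' kH)
  moreover have "N (\<lambda>z. d * H z) = d * N H" by (simp add: N_def)
  moreover have "d * N H < e"
  proof -
    have "d * N H \<le> d * (N H + 1)" using d by simp
    also have "\<dots> = e / 2" using NH by (simp add: d_def divide_simps)
    finally show ?thesis using e by simp
  qed
  ultimately show "\<exists>g' H. vague g' \<and> vague H \<and> (\<forall>z. \<bar>g z - g' z\<bar> \<le> H z) \<and> N H < e"
    using Ten_vague[OF Alg_mult_Ten[OF F(1) H(1)]] Ten_vague[OF dH]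
    by (intro exI[of _ "\<lambda>z. F z * H z"] exI[of _ "\<lambda>z. d * H z"]) auto
qed

end

section \<open>Limits near the diagonal\<close>

lemma eventually_one_le_mult:
  fixes d :: real
  assumes "d > 0"
  shows "\<forall>\<^sub>F n in sequentially. 1 \<le> real n * d"
  using eventually_ge_at_top[of "nat \<lceil>1 / d\<rceil>"]
proof eventually_elim
  case (elim n)
  then have "1 / d \<le> real n" by linarith
  then show ?case using assms by (simp add: field_simps)
qed

context jump_form
begin

lemma vague_continuity_set:
  assumes C: "compact C" "C \<subseteq> - diag" and \<Gamma>: "closure \<Gamma> \<subseteq> C" "\<Gamma> \<in> sets borel"
    and null: "AE z in J. (snd z, fst z) \<notin> frontier \<Gamma>" and \<psi>: "continuous_on UNIV \<psi>"
  shows "vague (\<lambda>z. indicator \<Gamma> z * \<psi> z)"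
proof (cases "\<Gamma> = {}")
  case True
  then show ?thesis using vague_continuous[of "\<lambda>_. 0" "{}"] by simp
next
  case False
  obtain H where H: "H \<in> Ten" "\<And>z. 0 \<le> H z" "\<And>z. z \<in> C \<Longrightarrow> 1 \<le> H z"
    using Ten_dominating[OF C] by blast
  obtain C' where C': "compact C'" "C' \<subseteq> - diag" "\<And>z. z \<notin> C' \<Longrightarrow> H z = 0"
    using vague_bcsupp(1)[OF Ten_vague[OF H(1)]] unfolding bcsupp_def by blast
  define H1 where "H1 z = min (H z) 1" for z
  have H1: "continuous_on UNIV H1" "\<And>z. 0 \<le> H1 z" "\<And>z. z \<in> C \<Longrightarrow> H1 z = 1"
      "\<And>z. z \<notin> C' \<Longrightarrow> H1 z = 0"
    using H(2,3) C'(3) Ten_continuous[OF H(1)]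
    unfolding H1_def by (auto intro!: continuous_on_min simp del: split_paired_All)
  have \<Gamma>C: "\<Gamma> \<subseteq> C" using \<Gamma>(1) closure_subset by blast
  have "bounded (\<psi> ` C)"
    using C(1) \<psi> by (intro compact_imp_bounded compact_continuous_image) (auto intro: continuous_on_subset)
  then obtain M where M: "M > 0" "\<And>z. z \<in> C \<Longrightarrow> \<bar>\<psi> z\<bar> \<le> M"
    by (force simp: bounded_pos)
  define a where "a n z = min 1 (real n * infdist z (- interior \<Gamma>))" for n z
  define b where "b n z = H1 z * max 0 (1 - real n * infdist z (closure \<Gamma>))" for n z
  define R where "R n z = M * (b n z - a n z)" for n z
  have "(undefined, undefined) \<in> (diag :: ('a \<times> 'a) set)" by (simp add: diag_def)
  then have ne: "- interior \<Gamma> \<noteq> {}" using \<Gamma>C C(2) interior_subset by blast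
  have cl_ne: "closure \<Gamma> \<noteq> {}" using False by simp
  have acont: "continuous_on UNIV (a n)" for n
    unfolding a_def by (intro continuous_intros)
  have bcont: "continuous_on UNIV (b n)" for n
    unfolding b_def using H1(1) by (intro continuous_intros)
  have a_bounds: "0 \<le> a n z" "a n z \<le> 1" for n z
    by (auto simp: a_def infdist_nonneg)
  have a0: "a n z = 0" if "z \<notin> interior \<Gamma>" for n z
    using that by (simp add: a_def)
  have b1: "b n z = 1" if "z \<in> closure \<Gamma>" for n z
    using that H1(3)[of z] \<Gamma>(1) by (auto simp: b_def)
  have b_bounds: "0 \<le> b n z" "b n z \<le> H1 z" for n z
    using H1(2)[of z] by (auto simp: b_def infdist_nonneg mult_left_le)
  have ab: "a n z \<le> indicator \<Gamma> z" "indicator \<Gamma> z \<le> b n z" for n z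
  proof -
    show "a n z \<le> indicator \<Gamma> z"
      using a_bounds[of n z] a0[of z n] interior_subset[of \<Gamma>] by (auto simp: indicator_def)
    show "indicator \<Gamma> z \<le> b n z"
      using b_bounds[of n z] b1[of z n] closure_subset[of \<Gamma>] by (auto simp: indicator_def)
  qed
  have Rcont: "continuous_on UNIV (R n)" for n
    unfolding R_def using acont bcont by (intro continuous_intros)
  have R0: "R n z = 0" if "z \<notin> C'" for n z
    using b_bounds[of n z] a_bounds[of n z] ab(1)[of n z] ab(2)[of z n] H1(4)[OF that] by (simp add: R_def)
  have Rv: "vague (R n)" for n
    using Rcont C'(1,2) R0 by (rule vague_continuous)
  have lim: "(\<lambda>n. N (R n)) \<longlonglongrightarrow> 0"
  proof -
    have "(\<lambda>n. \<integral>z. R n (snd z, fst z) \<partial>J) \<longlonglongrightarrow> (\<integral>z. 0 \<partial>J)"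
    proof (rule integral_dominated_convergence[where w = "\<lambda>z. M * H1 (snd z, fst z)"])
      have "bcsupp (- diag) (\<lambda>z. M * H1 z)"
        using H1 C' by (intro bcsupp_continuous[of _ C'] continuous_intros) auto
      then show "integrable J (\<lambda>z. M * H1 (snd z, fst z))" by (rule N_integrable)
      show "(\<lambda>z. R n (snd z, fst z)) \<in> borel_measurable J" for n
        using N_integrable[OF vague_bcsupp(1)[OF Rv]] by auto
      show "AE z in J. norm (R n (snd z, fst z)) \<le> M * H1 (snd z, fst z)" for n
      proof (rule AE_I2)
        fix z :: "'a \<times> 'a"
        let ?z = "(snd z, fst z)"
        have "0 \<le> b n ?z - a n ?z" "b n ?z - a n ?z \<le> H1 ?z"
          using ab(1)[of n ?z] ab(2)[of ?z n] b_bounds[of n ?z] a_bounds[of n ?z] by linarith+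
        then show "norm (R n ?z) \<le> M * H1 ?z" using M(1) by (simp add: R_def)
      qed
      show "AE z in J. (\<lambda>n. R n (snd z, fst z)) \<longlonglongrightarrow> 0"
        using null
      proof eventually_elim
        case (elim z)
        let ?z = "(snd z, fst z)"
        have "\<forall>\<^sub>F n in sequentially. R n ?z = 0"
        proof (cases "?z \<in> interior \<Gamma>")
          case True
          then have "infdist ?z (- interior \<Gamma>) > 0"
            using ne by (intro infdist_pos_not_in_closed) auto
          then have ev: "\<forall>\<^sub>F n in sequentially. 1 \<le> real n * infdist ?z (- interior \<Gamma>)"
            by (rule eventually_one_le_mult)
          have b1z: "b n ?z = 1" for n using True b1 interior_subset closure_subset by blast
          from ev show ?thesis by eventually_elim (simp add: R_def a_def b1z)
        next
          case False
          then have "?z \<notin> closure \<Gamma>" using elim by (simp add: frontier_def)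
          then have "infdist ?z (closure \<Gamma>) > 0"
            using cl_ne by (intro infdist_pos_not_in_closed) auto
          then have "\<forall>\<^sub>F n in sequentially. 1 \<le> real n * infdist ?z (closure \<Gamma>)"
            by (rule eventually_one_le_mult)
          then show ?thesis by eventually_elim (simp add: R_def b_def a0[OF False])
        qed
        then show ?case by (rule tendsto_eventually)
      qed
    qed simp_all
    then have "(\<lambda>n. 2 * (\<integral>z. R n (snd z, fst z) \<partial>J)) \<longlonglongrightarrow> 2 * 0"
      by (intro tendsto_intros) simp
    then show ?thesis by (simp add: N_def)
  qed
  show ?thesis
  proof (rule vague_squeeze)
    have "bcsupp (- diag) (\<lambda>z. H1 z * \<psi> z)"
      using H1 C' \<psi> by (intro bcsupp_continuous[of _ C'] continuous_intros) auto
    then have "bcsupp (- diag) (\<lambda>z. indicator \<Gamma> z * (H1 z * \<psi> z))"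
      using \<Gamma>(2) by (rule bcsupp_mult_indicator)
    moreover have "indicator \<Gamma> z * (H1 z * \<psi> z) = indicator \<Gamma> z * \<psi> z" for z
      using H1(3)[of z] \<Gamma>C by (auto simp: indicator_def)
    ultimately show "bcsupp (- diag) (\<lambda>z. indicator \<Gamma> z * \<psi> z)" by simp
  next
    fix e :: real assume "e > 0"
    then obtain n where n: "N (R n) < e"
      using eventually_happens'[OF sequentially_bot order_tendstoD(2)[OF lim]] by blast
    have "vague (\<lambda>z. a n z * \<psi> z)"
    proof (rule vague_continuous[of _ C])
      show "a n z * \<psi> z = 0" if "z \<notin> C" for z
        using that a0[of z n] \<Gamma>C interior_subset by auto
    qed (use C acont \<psi> in \<open>auto intro!: continuous_on_mult\<close>)
    moreover have "\<bar>indicator \<Gamma> z * \<psi> z - a n z * \<psi> z\<bar> \<le> R n z" for z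
    proof (cases "z \<in> C")
      case True
      have "\<bar>indicator \<Gamma> z * \<psi> z - a n z * \<psi> z\<bar> = (indicator \<Gamma> z - a n z) * \<bar>\<psi> z\<bar>"
        using ab(1)[of n z] by (simp add: left_diff_distrib[symmetric] abs_mult)
      also have "\<dots> \<le> (b n z - a n z) * M"
        using ab(1)[of n z] ab(2)[of z n] M(2)[OF True] by (intro mult_mono) auto
      finally show ?thesis by (simp add: R_def mult.commute)
    next
      case False
      then have "z \<notin> \<Gamma>" "z \<notin> interior \<Gamma>" using \<Gamma>C interior_subset by blast+
      then show ?thesis using a0 b_bounds(1)[of n z] M(1) by (simp add: R_def)
    qed
    ultimately show "\<exists>g' H. vague g' \<and> vague H \<and>
        (\<forall>z. \<bar>indicator \<Gamma> z * \<psi> z - g' z\<bar> \<le> H z) \<and> N H < e"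
      using Rv n by blast
  qed
qed

definition Gam :: "nat \<Rightarrow> ('a \<times> 'a) set" where
  "Gam l = {(x,y). x \<in> \<Omega> l \<and> y \<in> \<Omega> l \<and> dist x y \<ge> vs l}"

abbreviation "Lam l \<equiv> Lambda \<Omega> vs l"

lemma Gam_borel: "Gam l \<in> sets borel" and Lam_borel: "Lam l \<in> sets borel"
proof -
  have o: "open (\<Omega> l \<times> \<Omega> l)" using exhaustion(1) by (intro open_Times)
  have c: "closed {z::'a \<times> 'a. vs l \<le> dist (fst z) (snd z)}"
    by (intro closed_Collect_le continuous_intros)
  have "Gam l = (\<Omega> l \<times> \<Omega> l) \<inter> {z. vs l \<le> dist (fst z) (snd z)}" by (auto simp: Gam_def)
  then show "Gam l \<in> sets borel" using o c by auto
  have "Lam l = (\<Omega> l \<times> \<Omega> l) - {z. vs l \<le> dist (fst z) (snd z)}" by (auto simp: Lambda_def)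
  then show "Lam l \<in> sets borel" using o c by auto
qed

lemma vague_Gam:
  assumes "continuous_on UNIV \<psi>"
  shows "vague (\<lambda>z. indicator (Gam l) z * \<psi> z)"
proof -
  let ?C = "(closure (\<Omega> l) \<times> closure (\<Omega> l)) \<inter> {z. vs l \<le> dist (fst z) (snd z)}"
  have c: "closed {z::'a \<times> 'a. vs l \<le> dist (fst z) (snd z)}"
    by (intro closed_Collect_le continuous_intros)
  have C: "compact ?C" using c exhaustion(2) by (intro compact_Int_closed compact_Times)
  have off: "?C \<subseteq> - diag" using exhaustion(4)[of l] by (auto simp: diag_def)
  have "Gam l \<subseteq> ?C" using closure_subset by (auto simp: Gam_def)
  then have sub: "closure (Gam l) \<subseteq> ?C" using C by (intro closure_minimal compact_imp_closed)
  have "(snd z, fst z) \<in> Gam l \<longleftrightarrow> z \<in> Gam l" for z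
    by (cases z) (auto simp: Gam_def dist_commute)
  then have sym: "(snd z, fst z) \<in> frontier (Gam l) \<longleftrightarrow> z \<in> frontier (Gam l)" for z
    by (rule swap_frontier_symmetric)
  have "closed (frontier (Gam l))" by simp
  then have "frontier (Gam l) \<in> null_sets J"
    using exhaustion(6)[of l] J_sets by (auto simp: null_sets_def Gam_def)
  then have "AE z in J. z \<notin> frontier (Gam l)" by (rule AE_not_in)
  then have "AE z in J. (snd z, fst z) \<notin> frontier (Gam l)" by (simp add: sym)
  then show ?thesis using vague_continuity_set[OF C off sub Gam_borel] assms by blast
qed

lemma Lam_bcsupp:
  assumes "continuous_on UNIV \<psi>"
  shows "bcsupp UNIV (\<lambda>z. indicator (Lam l) z * \<psi> z)"
proof -
  have C: "compact (closure (\<Omega> l))" by (rule exhaustion(2))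
  obtain h e where h: "h \<in> V" "\<And>x. 0 \<le> h x" "\<And>x. h x \<le> 1" "supp h \<subseteq> UNIV" "e > 0"
    "\<And>x y. x \<in> closure (\<Omega> l) \<Longrightarrow> dist x y < e \<Longrightarrow> h y = 1"
    by (rule bump[OF C open_UNIV subset_UNIV]) (rule that)
  have h1: "h x = 1" if "x \<in> closure (\<Omega> l)" for x using h(5) h(6)[OF that, of x] by simp
  have "bcsupp UNIV (\<lambda>z. ten h h z * \<psi> z)"
    using h(1) assms
    by (intro bcsupp_continuous[of _ "supp h \<times> supp h"] continuous_on_mult ten_continuous compact_Times)
      (auto simp: ten_def C0_continuous C0_compact_supp intro: eq_0_off_supp ccontr)
  then have "bcsupp UNIV (\<lambda>z. indicator (Lam l) z * (ten h h z * \<psi> z))"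
    using Lam_borel by (rule bcsupp_mult_indicator)
  moreover have "indicator (Lam l) z * (ten h h z * \<psi> z) = indicator (Lam l) z * \<psi> z" for z
  proof (cases "z \<in> Lam l")
    case True
    then have "fst z \<in> closure (\<Omega> l)" "snd z \<in> closure (\<Omega> l)"
      using closure_subset[of "\<Omega> l"] by (auto simp: Lambda_def)
    then show ?thesis using h1 by (simp add: ten_def)
  qed simp
  ultimately show ?thesis by simp
qed

definition loc_lim :: "('a \<times> 'a \<Rightarrow> real) \<Rightarrow> real \<Rightarrow> bool" where
  "loc_lim \<psi> c \<longleftrightarrow> (\<exists>a. (\<forall>\<^sub>F l in sequentially.
     ((\<lambda>\<beta>. T \<beta> (\<lambda>z. indicator (Lam l) z * \<psi> z)) \<longlongrightarrow> a l) at_top) \<and> a \<longlonglongrightarrow> c)"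

lemma loc_lim_compact:
  assumes \<psi>: "continuous_on UNIV \<psi>" and Y: "compact Y" "\<And>z. z \<notin> Y \<times> Y \<Longrightarrow> \<psi> z = 0"
    and c: "((\<lambda>\<beta>. T \<beta> \<psi>) \<longlongrightarrow> c) at_top" and int: "integrable J (\<lambda>z. \<psi> (snd z, fst z))"
  shows "loc_lim \<psi> (c - N \<psi>)"
proof -
  have b: "bcsupp UNIV \<psi>"
    using \<psi> Y by (intro bcsupp_continuous[of _ "Y \<times> Y"] compact_Times) auto
  have "\<forall>\<^sub>F l in sequentially.
     ((\<lambda>\<beta>. T \<beta> (\<lambda>z. indicator (Lam l) z * \<psi> z)) \<longlongrightarrow> c - N (\<lambda>z. indicator (Gam l) z * \<psi> z)) at_top"
    using compact_eventually_subset_Omega[OF Y(1)]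
  proof eventually_elim
    case (elim l)
    have "((\<lambda>\<beta>. T \<beta> \<psi> - T \<beta> (\<lambda>z. indicator (Gam l) z * \<psi> z)) \<longlongrightarrow>
        c - N (\<lambda>z. indicator (Gam l) z * \<psi> z)) at_top"
      using c vague_Gam[OF \<psi>, of l] by (intro tendsto_diff) (auto simp: vague_def)
    moreover have "\<forall>\<^sub>F \<beta> in at_top. T \<beta> \<psi> - T \<beta> (\<lambda>z. indicator (Gam l) z * \<psi> z)
        = T \<beta> (\<lambda>z. indicator (Lam l) z * \<psi> z)"
      using eventually_gt_at_top[of 0]
    proof eventually_elim
      case (elim \<beta>)
      have "indicator (Lam l) z * \<psi> z = 1 * \<psi> z + (-1) * (indicator (Gam l) z * \<psi> z)" for z
        using Y(2)[of z] \<open>Y \<subseteq> \<Omega> l\<close> by (cases z) (auto simp: indicator_def Lambda_def Gam_def)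
      then show ?case
        using T_lincomb[OF b vague_bcsupp(2)[OF vague_Gam[OF \<psi>, of l]] elim, of 1 "-1"] by simp
    qed
    ultimately show ?case by (simp add: tendsto_cong)
  qed
  moreover have "(\<lambda>l. c - N (\<lambda>z. indicator (Gam l) z * \<psi> z)) \<longlonglongrightarrow> c - N \<psi>"
  proof -
    have "(\<lambda>l. \<integral>z. indicator (Gam l) (snd z, fst z) * \<psi> (snd z, fst z) \<partial>J)
        \<longlonglongrightarrow> (\<integral>z. \<psi> (snd z, fst z) \<partial>J)"
    proof (rule integral_dominated_convergence[where w = "\<lambda>z. \<bar>\<psi> (snd z, fst z)\<bar>"])
      show "(\<lambda>z. indicator (Gam l) (snd z, fst z) * \<psi> (snd z, fst z)) \<in> borel_measurable J" for l
        using N_integrable[OF vague_bcsupp(1)[OF vague_Gam[OF \<psi>, of l]]] by auto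
      show "AE z in J. (\<lambda>l. indicator (Gam l) (snd z, fst z) * \<psi> (snd z, fst z)) \<longlonglongrightarrow> \<psi> (snd z, fst z)"
        using J_diag
      proof eventually_elim
        case (elim z)
        then have "0 < dist (fst z) (snd z)" by simp
        then have "\<forall>\<^sub>F l in sequentially. vs l < dist (fst z) (snd z)"
          using order_tendstoD(2)[OF exhaustion(5)] by blast
        moreover have "\<forall>\<^sub>F l in sequentially. {fst z, snd z} \<subseteq> \<Omega> l"
          by (intro compact_eventually_subset_Omega) simp
        ultimately have "\<forall>\<^sub>F l in sequentially.
            indicator (Gam l) (snd z, fst z) * \<psi> (snd z, fst z) = \<psi> (snd z, fst z)"
          by eventually_elim (simp add: Gam_def dist_commute)
        then show ?case by (rule tendsto_eventually)
      qed
    qed (use int in \<open>auto simp: indicator_def\<close>)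
    then show ?thesis unfolding N_def by (intro tendsto_intros)
  qed
  ultimately show ?thesis
    unfolding loc_lim_def by (intro exI[of _ "\<lambda>l. c - N (\<lambda>z. indicator (Gam l) z * \<psi> z)"]) simp
qed

lemma loc_lim_lincomb:
  assumes "continuous_on UNIV \<phi>" "continuous_on UNIV \<psi>" "loc_lim \<phi> c" "loc_lim \<psi> d"
  shows "loc_lim (\<lambda>z. s * \<phi> z + t * \<psi> z) (s * c + t * d)"
proof -
  obtain a b where ab:
    "\<forall>\<^sub>F l in sequentially. ((\<lambda>\<beta>. T \<beta> (\<lambda>z. indicator (Lam l) z * \<phi> z)) \<longlongrightarrow> a l) at_top" "a \<longlonglongrightarrow> c"
    "\<forall>\<^sub>F l in sequentially. ((\<lambda>\<beta>. T \<beta> (\<lambda>z. indicator (Lam l) z * \<psi> z)) \<longlongrightarrow> b l) at_top" "b \<longlonglongrightarrow> d"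
    using assms(3,4) unfolding loc_lim_def by blast
  from ab(1,3) have "\<forall>\<^sub>F l in sequentially.
    ((\<lambda>\<beta>. T \<beta> (\<lambda>z. indicator (Lam l) z * (s * \<phi> z + t * \<psi> z))) \<longlongrightarrow> s * a l + t * b l) at_top"
  proof eventually_elim
    case (elim l)
    have "((\<lambda>\<beta>. s * T \<beta> (\<lambda>z. indicator (Lam l) z * \<phi> z) + t * T \<beta> (\<lambda>z. indicator (Lam l) z * \<psi> z))
        \<longlongrightarrow> s * a l + t * b l) at_top"
      using elim by (intro tendsto_intros)
    moreover have eq: "(\<lambda>z. indicator (Lam l) z * (s * \<phi> z + t * \<psi> z))
        = (\<lambda>z. s * (indicator (Lam l) z * \<phi> z) + t * (indicator (Lam l) z * \<psi> z))"
      by (simp add: algebra_simps)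
    have "\<forall>\<^sub>F \<beta> in at_top.
        s * T \<beta> (\<lambda>z. indicator (Lam l) z * \<phi> z) + t * T \<beta> (\<lambda>z. indicator (Lam l) z * \<psi> z)
        = T \<beta> (\<lambda>z. indicator (Lam l) z * (s * \<phi> z + t * \<psi> z))"
      using eventually_gt_at_top[of 0]
      unfolding eq
      by eventually_elim (simp add: T_lincomb[OF Lam_bcsupp[OF assms(1)] Lam_bcsupp[OF assms(2)]])
    ultimately show ?case by (simp add: tendsto_cong)
  qed
  moreover have "(\<lambda>l. s * a l + t * b l) \<longlonglongrightarrow> s * c + t * d"
    using ab(2,4) by (intro tendsto_intros)
  ultimately show ?thesis
    unfolding loc_lim_def by (intro exI[of _ "\<lambda>l. s * a l + t * b l"]) simp
qed

lemma loc_lim_cong: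
  assumes "loc_lim \<phi> c" "\<forall>\<^sub>F l in sequentially. \<forall>z\<in>Lam l. \<phi> z = \<psi> z"
  shows "loc_lim \<psi> c"
proof -
  obtain a where a:
    "\<forall>\<^sub>F l in sequentially. ((\<lambda>\<beta>. T \<beta> (\<lambda>z. indicator (Lam l) z * \<phi> z)) \<longlongrightarrow> a l) at_top" "a \<longlonglongrightarrow> c"
    using assms(1) unfolding loc_lim_def by blast
  from a(1) assms(2) have
    "\<forall>\<^sub>F l in sequentially. ((\<lambda>\<beta>. T \<beta> (\<lambda>z. indicator (Lam l) z * \<psi> z)) \<longlongrightarrow> a l) at_top"
  proof eventually_elim
    case (elim l)
    then have "(\<lambda>z. indicator (Lam l) z * \<phi> z) = (\<lambda>z. indicator (Lam l) z * \<psi> z)"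
      by (auto simp: indicator_def)
    then show ?case using elim(1) by simp
  qed
  with a(2) show ?thesis unfolding loc_lim_def by blast
qed

lemma loc_lim_le:
  assumes "continuous_on UNIV \<phi>" "continuous_on UNIV \<psi>" "loc_lim \<phi> c" "loc_lim \<psi> d"
    and le: "\<forall>\<^sub>F l in sequentially. \<forall>z\<in>Lam l. \<phi> z \<le> \<psi> z"
  shows "c \<le> d"
proof -
  obtain a b where ab:
    "\<forall>\<^sub>F l in sequentially. ((\<lambda>\<beta>. T \<beta> (\<lambda>z. indicator (Lam l) z * \<phi> z)) \<longlongrightarrow> a l) at_top" "a \<longlonglongrightarrow> c"
    "\<forall>\<^sub>F l in sequentially. ((\<lambda>\<beta>. T \<beta> (\<lambda>z. indicator (Lam l) z * \<psi> z)) \<longlongrightarrow> b l) at_top" "b \<longlonglongrightarrow> d"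
    using assms(3,4) unfolding loc_lim_def by blast
  from ab(1,3) le have "\<forall>\<^sub>F l in sequentially. a l \<le> b l"
  proof eventually_elim
    case (elim l)
    have "\<forall>\<^sub>F \<beta> in at_top. T \<beta> (\<lambda>z. indicator (Lam l) z * \<phi> z) \<le> T \<beta> (\<lambda>z. indicator (Lam l) z * \<psi> z)"
      using eventually_gt_at_top[of 0]
    proof eventually_elim
      case (elim \<beta>)
      then show ?case
        using \<open>\<forall>z\<in>Lam l. \<phi> z \<le> \<psi> z\<close>
        by (intro T_mono Lam_bcsupp assms) (auto simp: indicator_def)
    qed
    then show ?case using tendsto_le[OF trivial_limit_at_top_linorder elim(2,1)] by blast
  qed
  then show ?thesis using tendsto_le[OF sequentially_bot ab(4,2)] by blast
qed

end

section \<open>The energy functional\<close>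

definition delta :: "('a \<Rightarrow> real) \<Rightarrow> 'a \<times> 'a \<Rightarrow> real" where
  "delta u z = u (fst z) - u (snd z)"

lemma delta_continuous: "continuous_on UNIV u \<Longrightarrow> continuous_on UNIV (delta u)"
  unfolding delta_def[abs_def]
  by (intro continuous_on_diff continuous_on_UNIV_fst continuous_on_UNIV_snd)

context jump_form
begin

lemma bump_near_diagonal:
  assumes "compact X"
  obtains h e where "h \<in> V" "\<And>x. 0 \<le> h x" "\<And>x. h x \<le> 1" "\<And>x. x \<in> X \<Longrightarrow> h x = 1"
    "e > 0" "\<And>x y. x \<in> X \<Longrightarrow> dist x y < e \<Longrightarrow> h y = 1"
    "\<forall>\<^sub>F l in sequentially. \<forall>z\<in>Lam l. (fst z \<in> X \<longrightarrow> h (snd z) = 1) \<and> (snd z \<in> X \<longrightarrow> h (fst z) = 1)"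
proof -
  obtain h e where h: "h \<in> V" "\<And>x. 0 \<le> h x" "\<And>x. h x \<le> 1" "supp h \<subseteq> UNIV" "e > 0"
    "\<And>x y. x \<in> X \<Longrightarrow> dist x y < e \<Longrightarrow> h y = 1"
    by (rule bump[OF assms open_UNIV subset_UNIV]) (rule that)
  have "\<forall>\<^sub>F l in sequentially. vs l < e"
    using order_tendstoD(2)[OF exhaustion(5)] h(5) by blast
  then have ev: "\<forall>\<^sub>F l in sequentially. \<forall>z\<in>Lam l. (fst z \<in> X \<longrightarrow> h (snd z) = 1) \<and> (snd z \<in> X \<longrightarrow> h (fst z) = 1)"
  proof eventually_elim
    case (elim l)
    show ?case
    proof
      fix z assume "z \<in> Lam l"
      then have "dist (fst z) (snd z) < e" using elim by (auto simp: Lambda_def)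
      then show "(fst z \<in> X \<longrightarrow> h (snd z) = 1) \<and> (snd z \<in> X \<longrightarrow> h (fst z) = 1)"
        using h(6)[of "fst z" "snd z"] h(6)[of "snd z" "fst z"] by (simp add: dist_commute)
    qed
  qed
  have "h x = 1" if "x \<in> X" for x using h(5) h(6)[OF that, of x] by simp
  then show ?thesis by (rule that[OF h(1-3) _ h(5,6) ev])
qed

definition energy :: "('a \<Rightarrow> real) \<Rightarrow> ('a \<Rightarrow> real) \<Rightarrow> ('a \<Rightarrow> real) \<Rightarrow> real" where
  "energy u v f = Ec \<E> J K u (\<lambda>x. v x * f x) + Ec \<E> J K v (\<lambda>x. u x * f x)
     - Ec \<E> J K (\<lambda>x. u x * v x) f"

lemma loc_lim_energy:
  assumes u: "u \<in> V" and v: "v \<in> V" and f: "f \<in> V"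
  shows "loc_lim (\<lambda>z. delta u z * delta v z * f (fst z)) (energy u v f)"
proof -
  define X where "X = supp u \<union> supp v \<union> supp f"
  have X: "compact X" using u v f by (auto simp: X_def intro!: compact_Un C0_compact_supp)
  obtain h e where h0: "h \<in> V" "\<And>x. 0 \<le> h x" "\<And>x. h x \<le> 1" "\<And>x. x \<in> X \<Longrightarrow> h x = 1"
    "e > 0" "\<And>x y. x \<in> X \<Longrightarrow> dist x y < e \<Longrightarrow> h y = 1"
    and near: "\<forall>\<^sub>F l in sequentially. \<forall>z\<in>Lam l. (fst z \<in> X \<longrightarrow> h (snd z) = 1) \<and> (snd z \<in> X \<longrightarrow> h (fst z) = 1)"
    by (rule bump_near_diagonal[OF X]) (rule that)
  note h = h0(1,4,5,6)
  have X0: "u x = 0" "v x = 0" "f x = 0" if "x \<notin> X" for x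
    using that eq_0_off_supp by (auto simp: X_def)
  define uv where "uv x = u x * v x" for x
  define vf where "vf x = v x * f x" for x
  define uf where "uf x = u x * f x" for x
  define g where "g x = u x * vf x" for x
  have VV: "uv \<in> V" "vf \<in> V" "uf \<in> V" "g \<in> V"
    using u v f V_mult unfolding uv_def[abs_def] vf_def[abs_def] uf_def[abs_def] g_def[abs_def]
    by simp_all
  define \<phi> where "\<phi> z = delta u z * delta v z * f (fst z) * h (snd z)" for z
  have cont: "continuous_on UNIV u" "continuous_on UNIV v" "continuous_on UNIV f" "continuous_on UNIV h"
    using u v f h(1) V_continuous by auto
  have \<phi>cont: "continuous_on UNIV \<phi>"
    unfolding \<phi>_def
    using cont by (intro continuous_on_mult delta_continuous continuous_on_UNIV_fst continuous_on_UNIV_snd)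
  have \<phi>ten: "\<phi> z = (ten g h z - ten vf u z) - (ten uf v z - ten f uv z)" for z
    using X0[of "snd z"] h(2)[of "snd z"]
    by (cases "snd z \<in> X") (auto simp: \<phi>_def delta_def ten_def g_def vf_def uf_def uv_def algebra_simps)
  have lim: "((\<lambda>\<beta>. T \<beta> \<phi>) \<longlongrightarrow> \<E> u vf + \<E> v uf - \<E> uv f - \<E> h g) at_top"
  proof -
    have inner: "inner_L2 m h g = inner_L2 m u vf" "inner_L2 m v uf = inner_L2 m u vf"
      "inner_L2 m uv f = inner_L2 m u vf"
    proof -
      have "h x * g x = u x * vf x" for x
        using X0[of x] h(2)[of x] by (cases "x \<in> X") (auto simp: g_def)
      then show "inner_L2 m h g = inner_L2 m u vf" by (simp add: inner_L2_def)
    qed (simp_all add: inner_L2_def uf_def vf_def uv_def mult_ac)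
    have "((\<lambda>\<beta>. ((\<beta> * inner_L2 m u vf - T \<beta> (ten vf u)) + (\<beta> * inner_L2 m v uf - T \<beta> (ten uf v))
        - (\<beta> * inner_L2 m uv f - T \<beta> (ten f uv)) - (\<beta> * inner_L2 m h g - T \<beta> (ten g h))))
        \<longlongrightarrow> \<E> u vf + \<E> v uf - \<E> uv f - \<E> h g) at_top"
      using u v f h(1) VV by (intro tendsto_add tendsto_diff form_limit)
    moreover have "\<forall>\<^sub>F \<beta> in at_top.
      ((\<beta> * inner_L2 m u vf - T \<beta> (ten vf u)) + (\<beta> * inner_L2 m v uf - T \<beta> (ten uf v))
        - (\<beta> * inner_L2 m uv f - T \<beta> (ten f uv)) - (\<beta> * inner_L2 m h g - T \<beta> (ten g h))) = T \<beta> \<phi>"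
      using eventually_gt_at_top[of 0]
    proof eventually_elim
      case (elim \<beta>)
      note i = sigma_integrable[OF ten_bcsupp elim]
      have "T \<beta> \<phi> = (T \<beta> (ten g h) - T \<beta> (ten vf u)) - (T \<beta> (ten uf v) - T \<beta> (ten f uv))"
        using i[of g h] i[of vf u] i[of uf v] i[of f uv] u v f h(1) VV
        unfolding T_def \<phi>ten by (simp add: right_diff_distrib)
      then show ?case by (simp add: inner)
    qed
    ultimately show ?thesis by (simp add: tendsto_cong)
  qed
  define p where "p a b z = (a (snd z) - a (fst z)) * b (snd z)" for a b :: "'a \<Rightarrow> real" and z
  have pint: "integrable J (p u vf)" "integrable J (p v uf)" "integrable J (p uv f)" "integrable J (p h g)"
    unfolding p_def using u v f h(1) VV by (auto intro!: J_integrable)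
  have \<phi>swap: "\<phi> (snd z, fst z) = (p u vf z + p v uf z) - (p uv f z + p h g z)" for z
  proof -
    have "h (snd z) * g (snd z) = g (snd z)"
      using X0[of "snd z"] h(2)[of "snd z"] by (cases "snd z \<in> X") (auto simp: g_def)
    then have "p h g z = (1 - h (fst z)) * g (snd z)" by (simp add: p_def algebra_simps)
    then show ?thesis
      using X0[of "fst z"] h(2)[of "fst z"]
      by (cases "fst z \<in> X") (auto simp: \<phi>_def delta_def p_def g_def vf_def uf_def uv_def algebra_simps)
  qed
  have int: "integrable J (\<lambda>z. \<phi> (snd z, fst z))"
    unfolding \<phi>swap using pint by simp
  have N\<phi>: "N \<phi> = 2 * (\<integral>z. p u vf z \<partial>J) + 2 * (\<integral>z. p v uf z \<partial>J) - 2 * (\<integral>z. p uv f z \<partial>J)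
      - 2 * (\<integral>z. p h g z \<partial>J)"
    unfolding N_def \<phi>swap using pint by simp
  have Jterm: "(\<integral>z. 2 * (a (snd z) - a (fst z)) * b (snd z) \<partial>J) = 2 * (\<integral>z. p a b z \<partial>J)" for a b
    unfolding p_def mult.assoc by (rule integral_mult_right_zero)
  have "\<E> h g = 2 * (\<integral>z. p h g z \<partial>J) + (\<integral>x. h x * g x \<partial>K)"
  proof -
    let ?U = "\<Union>x\<in>X. ball x e"
    have "supp g \<subseteq> X"
      unfolding g_def[abs_def] X_def supp_def by (rule order_trans[OF closure_mono[of _ "{x. u x \<noteq> 0}"]]) auto
    moreover have "X \<subseteq> ?U" using h(3) by auto
    ultimately have "open ?U" "supp g \<subseteq> ?U" "\<forall>x\<in>?U. h x = 1" using h(4) by auto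
    then have "\<E> h g = (\<integral>z. 2 * (h (snd z) - h (fst z)) * g (snd z) \<partial>J) + (\<integral>x. h x * g x \<partial>K)"
      using JK h(1) VV(4) unfolding jumping_killing_def by blast
    then show ?thesis by (simp only: Jterm)
  qed
  moreover have "h x * g x = u x * vf x" for x
    using X0[of x] h(2)[of x] by (cases "x \<in> X") (auto simp: g_def)
  moreover have "v x * uf x = u x * vf x" "uv x * f x = u x * vf x" for x
    by (simp_all add: uf_def vf_def uv_def)
  ultimately have "energy u v f = \<E> u vf + \<E> v uf - \<E> uv f - \<E> h g - N \<phi>"
    unfolding energy_def uv_def[symmetric] uf_def[symmetric] vf_def[symmetric] Ec_def Jterm N\<phi>
    by simp
  moreover have "loc_lim \<phi> (\<E> u vf + \<E> v uf - \<E> uv f - \<E> h g - N \<phi>)"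
  proof (rule loc_lim_compact[OF \<phi>cont _ _ lim int])
    show "compact (X \<union> supp h)" using X h(1) by (auto intro: compact_Un C0_compact_supp)
    show "\<phi> z = 0" if "z \<notin> (X \<union> supp h) \<times> (X \<union> supp h)" for z
      using that X0[of "fst z"] eq_0_off_supp[of "snd z" h] by (cases z) (auto simp: \<phi>_def)
  qed
  ultimately have "loc_lim \<phi> (energy u v f)" by simp
  moreover from near have "\<forall>\<^sub>F l in sequentially. \<forall>z\<in>Lam l. \<phi> z = delta u z * delta v z * f (fst z)"
  proof eventually_elim
    case (elim l)
    show ?case
    proof
      fix z assume "z \<in> Lam l"
      then show "\<phi> z = delta u z * delta v z * f (fst z)"
        using elim X0(3)[of "fst z"] by (cases "fst z \<in> X") (auto simp: \<phi>_def)
    qed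
  qed
  ultimately show ?thesis by (rule loc_lim_cong)
qed

lemma loc_lim_Ehatc:
  assumes u: "u \<in> V" and v: "v \<in> V"
  shows "loc_lim (\<lambda>z. (u (snd z) - u (fst z)) * v (snd z)) (Ehatc \<sigma> \<Omega> vs u v)"
proof -
  let ?\<psi>0 = "\<lambda>z. (u (snd z) - u (fst z)) * v (snd z)"
  define X where "X = supp u \<union> supp v"
  have X: "compact X" using u v by (auto simp: X_def intro!: compact_Un C0_compact_supp)
  obtain h e where h0: "h \<in> V" "\<And>x. 0 \<le> h x" "\<And>x. h x \<le> 1" "\<And>x. x \<in> X \<Longrightarrow> h x = 1"
    "e > 0" "\<And>x y. x \<in> X \<Longrightarrow> dist x y < e \<Longrightarrow> h y = 1"
    and near: "\<forall>\<^sub>F l in sequentially. \<forall>z\<in>Lam l. (fst z \<in> X \<longrightarrow> h (snd z) = 1) \<and> (snd z \<in> X \<longrightarrow> h (fst z) = 1)"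
    by (rule bump_near_diagonal[OF X]) (rule that)
  note h = h0(1,4)
  have X0: "u x = 0" "v x = 0" if "x \<notin> X" for x
    using that eq_0_off_supp by (auto simp: X_def)
  define uv where "uv x = u x * v x" for x
  have uv: "uv \<in> V" using V_mult[OF u v] by (simp add: uv_def[abs_def])
  define \<psi> where "\<psi> z = ?\<psi>0 z * h (fst z)" for z
  have cont: "continuous_on UNIV u" "continuous_on UNIV v" "continuous_on UNIV h"
    using u v h(1) V_continuous by auto
  have \<psi>cont: "continuous_on UNIV \<psi>"
    unfolding \<psi>_def using cont
    by (intro continuous_on_mult continuous_on_diff continuous_on_UNIV_fst continuous_on_UNIV_snd)
  have \<psi>ten: "\<psi> z = ten h uv z - ten u v z" for z
    using X0[of "fst z"] h(2)[of "fst z"]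
    by (cases "fst z \<in> X") (auto simp: \<psi>_def ten_def uv_def algebra_simps)
  have lim: "((\<lambda>\<beta>. T \<beta> \<psi>) \<longlongrightarrow> \<E> v u - \<E> uv h) at_top"
  proof -
    have "uv x * h x = v x * u x" for x
      using X0[of x] h(2)[of x] by (cases "x \<in> X") (auto simp: uv_def)
    then have inner: "inner_L2 m uv h = inner_L2 m v u" by (simp add: inner_L2_def)
    have "((\<lambda>\<beta>. (\<beta> * inner_L2 m v u - T \<beta> (ten u v)) - (\<beta> * inner_L2 m uv h - T \<beta> (ten h uv)))
        \<longlongrightarrow> \<E> v u - \<E> uv h) at_top"
      using u v h(1) uv by (intro tendsto_diff form_limit)
    moreover have "\<forall>\<^sub>F \<beta> in at_top.
      (\<beta> * inner_L2 m v u - T \<beta> (ten u v)) - (\<beta> * inner_L2 m uv h - T \<beta> (ten h uv)) = T \<beta> \<psi>"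
      using eventually_gt_at_top[of 0]
    proof eventually_elim
      case (elim \<beta>)
      note i = sigma_integrable[OF ten_bcsupp elim]
      have "T \<beta> \<psi> = T \<beta> (ten h uv) - T \<beta> (ten u v)"
        using i[of h uv] i[of u v] u v h(1) uv unfolding T_def \<psi>ten by (simp add: right_diff_distrib)
      then show ?case by (simp add: inner)
    qed
    ultimately show ?thesis by (simp add: tendsto_cong)
  qed
  have int: "integrable J (\<lambda>z. \<psi> (snd z, fst z))"
  proof -
    have "integrable J (\<lambda>z. (v (snd z) - v (fst z)) * (u (snd z) * h (snd z))
        - (uv (snd z) - uv (fst z)) * h (snd z))"
      using J_integrable[OF v V_mult[OF u h(1)]] J_integrable[OF uv h(1)] by simp
    moreover have "\<psi> (snd z, fst z) = (v (snd z) - v (fst z)) * (u (snd z) * h (snd z))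
        - (uv (snd z) - uv (fst z)) * h (snd z)" for z
      by (simp add: \<psi>_def uv_def algebra_simps)
    ultimately show ?thesis by simp
  qed
  have "loc_lim \<psi> (\<E> v u - \<E> uv h - N \<psi>)"
  proof (rule loc_lim_compact[OF \<psi>cont _ _ lim int])
    show "compact (X \<union> supp h)" using X h(1) by (auto intro: compact_Un C0_compact_supp)
    show "\<psi> z = 0" if "z \<notin> (X \<union> supp h) \<times> (X \<union> supp h)" for z
      using that X0[of "snd z"] eq_0_off_supp[of "fst z" h] by (cases z) (auto simp: \<psi>_def)
  qed
  moreover from near have "\<forall>\<^sub>F l in sequentially. \<forall>z\<in>Lam l. \<psi> z = ?\<psi>0 z"
  proof eventually_elim
    case (elim l)
    show ?case
    proof
      fix z assume "z \<in> Lam l"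
      then show "\<psi> z = ?\<psi>0 z"
        using elim X0(2)[of "snd z"] by (cases "snd z \<in> X") (auto simp: \<psi>_def)
    qed
  qed
  ultimately have "loc_lim ?\<psi>0 (\<E> v u - \<E> uv h - N \<psi>)" by (rule loc_lim_cong)
  then obtain c where c: "loc_lim ?\<psi>0 c" ..
  then obtain a where a: "\<forall>\<^sub>F l in sequentially.
      ((\<lambda>\<beta>. T \<beta> (\<lambda>z. indicator (Lam l) z * ?\<psi>0 z)) \<longlongrightarrow> a l) at_top" "a \<longlonglongrightarrow> c"
    unfolding loc_lim_def by blast
  have "\<forall>\<^sub>F l in sequentially. a l = Lim at_top (\<lambda>\<beta>. T \<beta> (\<lambda>z. indicator (Lam l) z * ?\<psi>0 z))"
    using a(1) by eventually_elim (simp add: tendsto_Lim)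
  then have "(\<lambda>l. Lim at_top (\<lambda>\<beta>. T \<beta> (\<lambda>z. indicator (Lam l) z * ?\<psi>0 z))) \<longlonglongrightarrow> c"
    using a(2) by (simp add: tendsto_cong)
  then have "Ehatc \<sigma> \<Omega> vs u v = c" unfolding Ehatc_def T_def by (rule limI)
  with c show ?thesis by simp
qed

lemma loc_lim_third_order:
  assumes u: "u \<in> V" and v: "v \<in> V" and w: "w \<in> V"
    and \<psi>: "continuous_on UNIV \<psi>" "loc_lim \<psi> c" "M \<ge> 0"
      "\<And>z. \<bar>\<psi> z\<bar> \<le> M * (\<bar>delta u z\<bar> * \<bar>delta v z\<bar> * \<bar>delta w z\<bar>)"
  shows "c = 0"
proof -
  define X where "X = supp u \<union> supp v"
  have X: "compact X" using u v by (auto simp: X_def intro!: compact_Un C0_compact_supp)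
  obtain h e where h0: "h \<in> V" "\<And>x. 0 \<le> h x" "\<And>x. h x \<le> 1" "\<And>x. x \<in> X \<Longrightarrow> h x = 1"
    "e > 0" "\<And>x y. x \<in> X \<Longrightarrow> dist x y < e \<Longrightarrow> h y = 1"
    and near: "\<forall>\<^sub>F l in sequentially. \<forall>z\<in>Lam l. (fst z \<in> X \<longrightarrow> h (snd z) = 1) \<and> (snd z \<in> X \<longrightarrow> h (fst z) = 1)"
    by (rule bump_near_diagonal[OF X]) (rule that)
  note h = h0(1,2,4)
  have X0: "u x = 0" "v x = 0" if "x \<notin> X" for x
    using that eq_0_off_supp by (auto simp: X_def)
  define S where "S z = 1 * (delta u z * delta u z * h (fst z)) + 1 * (delta v z * delta v z * h (fst z))" for z
  define A where "A = 1 * energy u u h + 1 * energy v v h"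
  have cont: "continuous_on UNIV (\<lambda>z. delta u z * delta u z * h (fst z))"
      "continuous_on UNIV (\<lambda>z. delta v z * delta v z * h (fst z))"
    using u v h(1) V_continuous by (auto intro!: continuous_on_mult delta_continuous continuous_on_UNIV_fst)
  have Scont: "continuous_on UNIV S"
    unfolding S_def by (intro continuous_on_add continuous_on_mult[OF continuous_on_const] cont)
  have SA: "loc_lim S A"
    unfolding S_def A_def
    by (intro loc_lim_lincomb cont loc_lim_energy u v h(1))
  have le: "s * c \<le> M * e * A" if e: "e > 0" and s: "s = 1 \<or> s = -1" for e s :: real
  proof -
    have wC: "w \<in> C0" using w by simp
    obtain d where d: "d > 0" "\<And>x y. dist x y < d \<Longrightarrow> \<bar>w x - w y\<bar> < e"
      using C0_uniformly_small[OF wC e] by blast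
    have "\<forall>\<^sub>F l in sequentially. vs l < d"
      using order_tendstoD(2)[OF exhaustion(5)] d(1) by blast
    with near have ev: "\<forall>\<^sub>F l in sequentially. \<forall>z\<in>Lam l. s * \<psi> z + 0 * S z \<le> M * e * S z + 0 * S z"
    proof eventually_elim
      case (elim l)
      show ?case
      proof
        fix z assume z: "z \<in> Lam l"
        have "dist (fst z) (snd z) < d" using z elim(2) by (auto simp: Lambda_def)
        then have dw: "\<bar>delta w z\<bar> \<le> e" using d(2) by (force simp: delta_def)
        have "\<bar>delta u z\<bar> * \<bar>delta v z\<bar> \<le> S z"
        proof (cases "fst z \<in> X \<or> snd z \<in> X")
          case True
          then have "h (fst z) = 1" using elim(1) z h(3) by auto
          then have "S z = \<bar>delta u z\<bar>\<^sup>2 + \<bar>delta v z\<bar>\<^sup>2" by (simp add: S_def power2_eq_square)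
          moreover have "2 * (\<bar>delta u z\<bar> * \<bar>delta v z\<bar>) \<le> \<bar>delta u z\<bar>\<^sup>2 + \<bar>delta v z\<bar>\<^sup>2"
            using sum_squares_bound[of "\<bar>delta u z\<bar>" "\<bar>delta v z\<bar>"] by simp
          moreover have "0 \<le> \<bar>delta u z\<bar> * \<bar>delta v z\<bar>" by simp
          ultimately show ?thesis by linarith
        next
          case False
          then show ?thesis using X0 by (simp add: S_def delta_def)
        qed
        then have "\<bar>delta u z\<bar> * \<bar>delta v z\<bar> * \<bar>delta w z\<bar> \<le> S z * e"
          using dw by (intro mult_mono) (auto intro: order_trans[OF _ \<open>_ \<le> S z\<close>])
        then have "M * (\<bar>delta u z\<bar> * \<bar>delta v z\<bar> * \<bar>delta w z\<bar>) \<le> M * (S z * e)"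
          using \<psi>(3) by (rule mult_left_mono)
        then have "\<bar>\<psi> z\<bar> \<le> M * e * S z" using \<psi>(4)[of z] by (simp add: mult_ac)
        then show "s * \<psi> z + 0 * S z \<le> M * e * S z + 0 * S z" using s by auto
      qed
    qed
    have "s * c + 0 * A \<le> M * e * A + 0 * A"
      by (rule loc_lim_le[OF _ _ _ _ ev])
        (intro loc_lim_lincomb continuous_on_add continuous_on_mult continuous_on_const \<psi>(1,2) Scont SA)+
    then show ?thesis by simp
  qed
  have "\<bar>c\<bar> \<le> M * A * e" if "e > 0" for e
    using le[OF that, of 1] le[OF that, of "-1"] by (simp add: mult_ac abs_le_iff)
  moreover have "((\<lambda>e. M * A * e) \<longlongrightarrow> M * A * 0) (at_right 0)"
    by (intro tendsto_intros)
  ultimately have "\<bar>c\<bar> \<le> M * A * 0"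
    by (intro tendsto_lowerbound[of "\<lambda>e. M * A * e" _ "at_right 0"])
      (auto simp: eventually_at_right_less elim: eventually_mono[OF eventually_at_right_less])
  then show ?thesis by simp
qed

lemma energy_Ehatc:
  assumes u: "u \<in> V" and v: "v \<in> V" and f: "f \<in> V"
  shows "energy u v f = Ehatc \<sigma> \<Omega> vs u (\<lambda>x. v x * f x) + Ehatc \<sigma> \<Omega> vs v (\<lambda>x. u x * f x)
     - Ehatc \<sigma> \<Omega> vs (\<lambda>x. u x * v x) f"
proof -
  let ?L = "\<lambda>a b z. (a (snd z) - a (fst z)) * b (snd z)"
  let ?E = "Ehatc \<sigma> \<Omega> vs"
  let ?vf = "\<lambda>x. v x * f x" and ?uf = "\<lambda>x. u x * f x" and ?uv = "\<lambda>x. u x * v x"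
  have VV: "?vf \<in> V" "?uf \<in> V" "?uv \<in> V" using u v f V_mult by auto
  have Lcont: "continuous_on UNIV (?L a b)" if "a \<in> V" "b \<in> V" for a b
    using that[THEN V_continuous]
    by (intro continuous_on_mult continuous_on_diff continuous_on_UNIV_fst continuous_on_UNIV_snd)
  have Dcont: "continuous_on UNIV (\<lambda>z. delta u z * delta v z * f (fst z))"
    using u v f V_continuous by (intro continuous_on_mult delta_continuous continuous_on_UNIV_fst) auto
  define S where "S z = 1 * (1 * ?L u ?vf z + 1 * ?L v ?uf z) + (-1) * ?L ?uv f z" for z
  have S: "loc_lim S (1 * (1 * ?E u ?vf + 1 * ?E v ?uf) + (-1) * ?E ?uv f)"
    unfolding S_def
    by (intro loc_lim_lincomb loc_lim_Ehatc continuous_on_add continuous_on_mult[OF continuous_on_const]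
        Lcont u v f VV)
  have Scont: "continuous_on UNIV S"
    unfolding S_def
    by (intro continuous_on_add continuous_on_mult[OF continuous_on_const] Lcont u v f VV)
  have lim: "loc_lim (\<lambda>z. 1 * (delta u z * delta v z * f (fst z)) + (-1) * S z)
    (1 * energy u v f + (-1) * (1 * (1 * ?E u ?vf + 1 * ?E v ?uf) + (-1) * ?E ?uv f))"
    by (intro loc_lim_lincomb Dcont Scont S loc_lim_energy u v f)
  have eq: "1 * (delta u z * delta v z * f (fst z)) + (-1) * S z = delta u z * delta v z * delta f z" for z
    by (simp add: S_def delta_def algebra_simps)
  have "continuous_on UNIV (\<lambda>z. delta u z * delta v z * delta f z)"
    using u v f V_continuous by (intro continuous_on_mult delta_continuous) auto
  then have "1 * energy u v f + (-1) * (1 * (1 * ?E u ?vf + 1 * ?E v ?uf) + (-1) * ?E ?uv f) = 0"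
    by (rule loc_lim_third_order[OF u v f _ lim[unfolded eq], of 1]) (simp_all add: abs_mult)
  then show ?thesis by simp
qed

lemma energy_Leibniz:
  assumes u: "u \<in> V" and v: "v \<in> V" and w: "w \<in> V" and f: "f \<in> V"
  shows "energy (\<lambda>x. u x * v x) w f = energy v w (\<lambda>x. u x * f x) + energy u w (\<lambda>x. v x * f x)"
proof -
  let ?vf = "\<lambda>x. v x * f x" and ?uf = "\<lambda>x. u x * f x" and ?uv = "\<lambda>x. u x * v x"
  let ?L = "\<lambda>a b g z. delta a z * delta b z * g (fst z)"
  have VV: "?vf \<in> V" "?uf \<in> V" "?uv \<in> V" using u v f V_mult by auto
  have Lcont: "continuous_on UNIV (?L a b g)" if "a \<in> V" "b \<in> V" "g \<in> V" for a b g
    using that[THEN V_continuous]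
    by (intro continuous_on_mult delta_continuous continuous_on_UNIV_fst)
  have "loc_lim (\<lambda>z. 1 * (1 * ?L v w ?uf z + 1 * ?L u w ?vf z) + (-1) * ?L ?uv w f z)
      (1 * (1 * energy v w ?uf + 1 * energy u w ?vf) + (-1) * energy ?uv w f)"
    by (intro loc_lim_lincomb loc_lim_energy continuous_on_add continuous_on_mult[OF continuous_on_const]
        Lcont u v w f VV)
  moreover have "1 * (1 * ?L v w ?uf z + 1 * ?L u w ?vf z) + (-1) * ?L ?uv w f z
      = delta u z * delta v z * delta w z * f (fst z)" for z
    by (simp add: delta_def algebra_simps)
  ultimately have lim: "loc_lim (\<lambda>z. delta u z * delta v z * delta w z * f (fst z))
      (energy v w ?uf + energy u w ?vf - energy ?uv w f)"
    by simp
  obtain B where B: "B > 0" "\<And>x. \<bar>f x\<bar> \<le> B" using C0_bounded[of f] f by auto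
  have "continuous_on UNIV (\<lambda>z. delta u z * delta v z * delta w z * f (fst z))"
    using u v w f V_continuous by (intro continuous_on_mult delta_continuous continuous_on_UNIV_fst) auto
  moreover have "\<bar>delta u z * delta v z * delta w z * f (fst z)\<bar>
      \<le> B * (\<bar>delta u z\<bar> * \<bar>delta v z\<bar> * \<bar>delta w z\<bar>)" for z
    using mult_right_mono[OF B(2)[of "fst z"], of "\<bar>delta u z\<bar> * \<bar>delta v z\<bar> * \<bar>delta w z\<bar>"]
    by (simp add: abs_mult mult_ac)
  ultimately have "energy v w ?uf + energy u w ?vf - energy ?uv w f = 0"
    using B(1) by (intro loc_lim_third_order[OF u v w _ lim, of B]) auto
  then show ?thesis by simp
qed

end

section \<open>Energy measures\<close>

lemma signed_radon_integrable:
  assumes "signed_radon \<mu>" "bcsupp UNIV g"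
  shows "integrable (fst \<mu>) g" "integrable (snd \<mu>) g"
  using assms by (auto simp: signed_radon_def radon_measure_def intro!: bcsupp_integrable[OF assms(2)])

lemma bcsupp_mult_continuous:
  assumes g: "bcsupp S g" and c: "continuous_on UNIV c"
  shows "bcsupp S (\<lambda>x. g x * c x)"
proof -
  obtain B where B: "\<And>x. \<bar>g x\<bar> \<le> B" using g unfolding bcsupp_def by blast
  obtain C where C: "compact C" "C \<subseteq> S" "\<And>x. x \<notin> C \<Longrightarrow> g x = 0"
    using g unfolding bcsupp_def by blast
  have "bounded (c ` C)"
    using C c by (intro compact_imp_bounded compact_continuous_image) (auto intro: continuous_on_subset)
  then obtain B' where B': "B' > 0" "\<And>x. x \<in> C \<Longrightarrow> \<bar>c x\<bar> \<le> B'"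
    by (force simp: bounded_pos)
  have "B \<ge> 0" using B[of undefined] by linarith
  have "\<bar>g x * c x\<bar> \<le> B * B'" for x
  proof (cases "x \<in> C")
    case True
    then show ?thesis using B[of x] B'(2)[OF True] by (simp add: abs_mult mult_mono)
  qed (use C(3) B'(1) \<open>B \<ge> 0\<close> in auto)
  moreover have "(\<lambda>x. g x * c x) \<in> borel_measurable borel"
    using g borel_measurable_continuous_onI[OF c] by (auto simp: bcsupp_def)
  moreover have "g x * c x = 0" if "x \<notin> C" for x using C(3)[OF that] by simp
  ultimately show ?thesis using C(1,2) unfolding bcsupp_def by blast
qed

lemma sint_mult_lincomb:
  assumes "signed_radon \<mu>" "continuous_on UNIV c" "bcsupp UNIV f" "bcsupp UNIV g"
  shows "sint \<mu> (\<lambda>x. (a * f x + b * g x) * c x)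
    = a * sint \<mu> (\<lambda>x. f x * c x) + b * sint \<mu> (\<lambda>x. g x * c x)"
proof -
  have "integrable (fst \<mu>) (\<lambda>x. f x * c x)" "integrable (snd \<mu>) (\<lambda>x. f x * c x)"
    "integrable (fst \<mu>) (\<lambda>x. g x * c x)" "integrable (snd \<mu>) (\<lambda>x. g x * c x)"
    using assms by (auto intro!: signed_radon_integrable bcsupp_mult_continuous)
  moreover have "(a * f x + b * g x) * c x = a * (f x * c x) + b * (g x * c x)" for x
    by (simp add: algebra_simps)
  ultimately show ?thesis by (simp add: sint_def right_diff_distrib)
qed

lemma sint_mult_tendsto:
  fixes g :: "nat \<Rightarrow> 'a::metric_space \<Rightarrow> real"
  assumes \<mu>: "signed_radon \<mu>" and c: "continuous_on UNIV c" and C: "compact C"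
    and g: "\<And>n. g n \<in> borel_measurable borel" "\<And>n x. \<bar>g n x\<bar> \<le> B" "\<And>n x. x \<notin> C \<Longrightarrow> g n x = 0"
    and lim: "\<And>x. (\<lambda>n. g n x) \<longlonglongrightarrow> f x"
  shows "(\<lambda>n. sint \<mu> (\<lambda>x. g n x * c x)) \<longlonglongrightarrow> sint \<mu> (\<lambda>x. f x * c x)"
proof -
  have Cb: "C \<in> sets borel" using C by (simp add: borel_compact)
  have "B \<ge> 0" using g(2)[of 0 undefined] by linarith
  have "bcsupp UNIV (\<lambda>x. B * indicator C x)"
    unfolding bcsupp_def
    using C Cb \<open>B \<ge> 0\<close> by (auto intro!: exI[of _ B] exI[of _ C] simp: indicator_def)
  then have dom: "bcsupp UNIV (\<lambda>x. B * indicator C x * \<bar>c x\<bar>)"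
    by (rule bcsupp_mult_continuous[OF _ continuous_on_rabs[OF c]])
  have cb: "c \<in> borel_measurable borel" using c by (rule borel_measurable_continuous_onI)
  have fb: "f \<in> borel_measurable borel" using lim g(1) by (rule borel_measurable_LIMSEQ_real)
  have "(\<lambda>n. \<integral>x. g n x * c x \<partial>M) \<longlonglongrightarrow> (\<integral>x. f x * c x \<partial>M)"
    if M: "sets M = sets borel" "integrable M (\<lambda>x. B * indicator C x * \<bar>c x\<bar>)" for M
  proof (rule integral_dominated_convergence[where w = "\<lambda>x. B * indicator C x * \<bar>c x\<bar>"])
    have mb: "borel_measurable M = borel_measurable borel"
      using M(1) by (intro measurable_cong_sets) auto
    show "(\<lambda>x. f x * c x) \<in> borel_measurable M" "\<And>n. (\<lambda>x. g n x * c x) \<in> borel_measurable M"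
      unfolding mb using fb cb g(1) by auto
    show "AE x in M. (\<lambda>n. g n x * c x) \<longlonglongrightarrow> f x * c x"
      by (intro AE_I2 tendsto_mult lim tendsto_const)
    show "AE x in M. norm (g n x * c x) \<le> B * indicator C x * \<bar>c x\<bar>" for n
    proof (rule AE_I2)
      fix x
      have "\<bar>g n x\<bar> \<le> B * indicator C x" using g(2)[of n x] g(3)[of x n] by (auto simp: indicator_def)
      then show "norm (g n x * c x) \<le> B * indicator C x * \<bar>c x\<bar>"
        by (simp add: abs_mult mult_right_mono)
    qed
  qed (rule M(2))
  then show ?thesis
    unfolding sint_def using \<mu> signed_radon_integrable[OF \<mu> dom]
    by (intro tendsto_diff) (auto simp: signed_radon_def radon_measure_def)
qed

lemma functional_vanishes_on_borel:
  fixes F :: "('a::metric_space \<Rightarrow> real) \<Rightarrow> real"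
  assumes lin: "\<And>a b f g. bcsupp UNIV f \<Longrightarrow> bcsupp UNIV g \<Longrightarrow>
      F (\<lambda>x. a * f x + b * g x) = a * F f + b * F g"
    and conv: "\<And>B C g f. compact C \<Longrightarrow> (\<And>n::nat. g n \<in> borel_measurable borel) \<Longrightarrow>
      (\<And>n x. \<bar>g n x\<bar> \<le> B) \<Longrightarrow> (\<And>n x. x \<notin> C \<Longrightarrow> g n x = 0) \<Longrightarrow>
      (\<And>x. (\<lambda>n. g n x) \<longlonglongrightarrow> f x) \<Longrightarrow> (\<lambda>n. F (g n)) \<longlonglongrightarrow> F f"
    and zero: "\<And>g. g \<in> C0 \<Longrightarrow> F g = 0"
    and W: "open W" "compact (closure W)" and A: "A \<in> sets borel"
  shows "F (indicator (A \<inter> W)) = 0"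
proof -
  have Wcl: "W \<subseteq> closure W" by (rule closure_subset)
  have bc: "bcsupp UNIV (indicator (A \<inter> W) :: 'a \<Rightarrow> real)" if "A \<in> sets borel" for A
    unfolding bcsupp_def using that W Wcl
    by (auto intro!: exI[of _ 1] exI[of _ "closure W"] borel_measurable_indicator simp: indicator_def)
  have opn: "F (indicator (A \<inter> W)) = 0" if "open A" for A
  proof -
    define S where "S = A \<inter> W"
    have S: "open S" "S \<subseteq> closure W" using that W Wcl by (auto simp: S_def)
    show ?thesis
    proof (cases "- S = {}")
      case True
      then have "S = UNIV" by auto
      then have "indicator S = (\<lambda>x. 1::real)" "closure W = UNIV" using S(2) by (auto simp: indicator_def)
      moreover have "(\<lambda>x::'a. 1::real) \<in> C0"
        using \<open>closure W = UNIV\<close> W(2) by (intro C0I[of _ UNIV]) auto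
      ultimately show ?thesis using zero by (simp add: S_def)
    next
      case False
      define g where "g n x = min 1 (real n * infdist x (- S))" for n x
      have gcont: "continuous_on UNIV (g n)" for n
        unfolding g_def by (intro continuous_intros)
      have g0: "g n x = 0" if "x \<notin> S" for n x using that by (simp add: g_def)
      have "g n \<in> C0" for n
        using S(2) g0 by (intro C0I[OF gcont W(2)]) auto
      then have "F (g n) = 0" for n by (rule zero)
      moreover have "(\<lambda>n. F (g n)) \<longlonglongrightarrow> F (indicator S)"
      proof (rule conv[OF W(2), where B = 1])
        show "g n \<in> borel_measurable borel" for n using gcont by (rule borel_measurable_continuous_onI)
        show "\<bar>g n x\<bar> \<le> 1" for n x
        proof -
          have "0 \<le> real n * infdist x (- S)" by (simp add: infdist_nonneg)
          then show ?thesis unfolding g_def by linarith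
        qed
        show "g n x = 0" if "x \<notin> closure W" for n x using that S(2) g0 by blast
        show "(\<lambda>n. g n x) \<longlonglongrightarrow> indicator S x" for x
        proof (cases "x \<in> S")
          case True
          then have "infdist x (- S) > 0"
            using False S(1) by (intro infdist_pos_not_in_closed) auto
          then have "\<forall>\<^sub>F n in sequentially. g n x = 1"
            by (rule eventually_mono[OF eventually_one_le_mult]) (simp add: g_def)
          then show ?thesis using True by (simp add: tendsto_eventually)
        qed (simp add: g0)
      qed
      ultimately show ?thesis by (simp add: S_def LIMSEQ_const_iff)
    qed
  qed
  have borel_eq: "sigma_sets UNIV {S::'a set. open S} = sets borel" by (simp add: borel_def)
  have "Int_stable {S::'a set. open S}" "{S::'a set. open S} \<subseteq> Pow UNIV"
      "A \<in> sigma_sets UNIV {S. open S}"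
    using A borel_eq by (auto simp: Int_stable_def)
  then show ?thesis
  proof (induction rule: sigma_sets_induct_disjoint)
    case (basic A)
    then show ?case using opn by simp
  next
    case empty
    show ?case by (rule opn) simp
  next
    case (compl A)
    have "indicator ((UNIV - A) \<inter> W) = (\<lambda>x. 1 * indicator (UNIV \<inter> W) x + (-1) * indicator (A \<inter> W) x :: real)"
      by (auto simp: indicator_def)
    moreover have "A \<in> sets borel" using compl borel_eq by simp
    ultimately show ?case
      using lin[OF bc[of UNIV] bc[of A], of 1 "-1"] opn[of UNIV] compl.IH by simp
  next
    case (union A)
    have Ab: "A i \<in> sets borel" for i using union(2) borel_eq by auto
    have UAb: "(\<Union>i<n. A i) \<in> sets borel" for n using Ab by auto
    have fin: "F (indicator ((\<Union>i<n. A i) \<inter> W)) = 0" for n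
    proof (induction n)
      case 0
      show ?case by (rule opn) simp
    next
      case (Suc n)
      have "(\<Union>i<n. A i) \<inter> A n = {}"
        using union(1) unfolding disjoint_family_on_def by (fastforce dest: less_imp_neq)
      then have "indicator ((\<Union>i<Suc n. A i) \<inter> W)
          = (\<lambda>x. 1 * indicator ((\<Union>i<n. A i) \<inter> W) x + 1 * indicator (A n \<inter> W) x :: real)"
        by (auto simp: indicator_def lessThan_Suc fun_eq_iff)
      then show ?case using lin[OF bc[OF UAb] bc[OF Ab], of 1 n 1 n] Suc union.IH by simp
    qed
    have "(\<lambda>n. F (indicator ((\<Union>i<n. A i) \<inter> W))) \<longlonglongrightarrow> F (indicator ((\<Union>i. A i) \<inter> W))"
    proof (rule conv[OF W(2), where B = 1])
      show "indicator ((\<Union>i<n. A i) \<inter> W) \<in> borel_measurable borel" for n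
        using UAb W(1) by (intro borel_measurable_indicator) auto
      show "\<bar>indicator ((\<Union>i<n. A i) \<inter> W) x\<bar> \<le> (1::real)" for n x by (simp add: indicator_def)
      show "indicator ((\<Union>i<n. A i) \<inter> W) x = (0::real)" if "x \<notin> closure W" for n x
        using that Wcl by (auto simp: indicator_def)
      show "(\<lambda>n. indicator ((\<Union>i<n. A i) \<inter> W) x :: real) \<longlonglongrightarrow> indicator ((\<Union>i. A i) \<inter> W) x" for x
      proof (cases "x \<in> (\<Union>i. A i)")
        case True
        then obtain k where "x \<in> A k" by blast
        have "\<forall>\<^sub>F n in sequentially. (indicator ((\<Union>i<n. A i) \<inter> W) x :: real) = indicator ((\<Union>i. A i) \<inter> W) x"
          using eventually_gt_at_top[of k]
          by eventually_elim (use \<open>x \<in> A k\<close> in \<open>auto simp: indicator_def\<close>)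
        then show ?thesis by (rule tendsto_eventually)
      qed (auto simp: indicator_def)
    qed
    then show ?case by (simp add: fin LIMSEQ_const_iff)
  qed
qed

context jump_form
begin

lemma energy_measure_Leibniz:
  assumes mu: "energy_measures D \<E> J K \<mu>"
    and u: "u \<in> V" and v: "v \<in> V" and w: "w \<in> V"
    and A: "A \<in> sets borel" "compact (closure A)"
  shows "sint (\<mu> (\<lambda>x. u x * v x) w) (indicator A)
    = sint (\<mu> v w) (\<lambda>x. indicator A x * u x) + sint (\<mu> u w) (\<lambda>x. indicator A x * v x)"
proof -
  have uv: "(\<lambda>x. u x * v x) \<in> V" using V_mult[OF u v] .
  have sr: "signed_radon (\<mu> a b)" if "a \<in> V" "b \<in> V" for a b
    using mu that unfolding energy_measures_def by blast
  have se: "sint (\<mu> a b) f = energy a b f" if "a \<in> V" "b \<in> V" "f \<in> V" for a b f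
    using mu that unfolding energy_measures_def energy_def by blast
  note srs = sr[OF uv w] sr[OF v w] sr[OF u w]
  note cs = continuous_on_const[of UNIV "1::real"] V_continuous[OF u] V_continuous[OF v]
  define F where "F g = sint (\<mu> (\<lambda>x. u x * v x) w) (\<lambda>x. g x * 1)
      - sint (\<mu> v w) (\<lambda>x. g x * u x) - sint (\<mu> u w) (\<lambda>x. g x * v x)" for g
  have FV: "F g = 0" if g: "g \<in> V" for g
  proof -
    have "(\<lambda>x. g x * u x) \<in> V" "(\<lambda>x. g x * v x) \<in> V" using g u v V_mult by auto
    then have "F g = energy (\<lambda>x. u x * v x) w g - energy v w (\<lambda>x. g x * u x) - energy u w (\<lambda>x. g x * v x)"
      using g u v w uv by (simp add: F_def se)
    then show ?thesis using energy_Leibniz[OF u v w g] by (simp add: mult.commute)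
  qed
  have lin: "F (\<lambda>x. a * f x + b * g x) = a * F f + b * F g" if "bcsupp UNIV f" "bcsupp UNIV g" for a b f g
    unfolding F_def sint_mult_lincomb[OF srs(1) cs(1) that] sint_mult_lincomb[OF srs(2) cs(2) that]
      sint_mult_lincomb[OF srs(3) cs(3) that] by (simp add: algebra_simps)
  have conv: "(\<lambda>n. F (g n)) \<longlonglongrightarrow> F f"
    if "compact C" "\<And>n::nat. g n \<in> borel_measurable borel" "\<And>n x. \<bar>g n x\<bar> \<le> B"
      "\<And>n x. x \<notin> C \<Longrightarrow> g n x = 0" "\<And>x. (\<lambda>n. g n x) \<longlonglongrightarrow> f x" for B C g f
    unfolding F_def
    by (intro tendsto_diff sint_mult_tendsto[OF srs(1) cs(1) that] sint_mult_tendsto[OF srs(2) cs(2) that]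
        sint_mult_tendsto[OF srs(3) cs(3) that])
  have zero: "F g = 0" if g: "g \<in> C0" for g
  proof -
    obtain h e where h: "h \<in> V" "\<And>x. 0 \<le> h x" "\<And>x. h x \<le> 1" "supp h \<subseteq> UNIV" "e > 0"
      "\<And>x y. x \<in> supp g \<Longrightarrow> dist x y < e \<Longrightarrow> h y = 1"
      by (rule bump[OF C0_compact_supp[OF g] open_UNIV subset_UNIV]) (rule that)
    have gh: "g x * h x = g x" for x
      using h(5) h(6)[of x x] eq_0_off_supp[of x g] by (cases "x \<in> supp g") auto
    have dense: "\<forall>g\<in>C0. \<forall>e>0. \<exists>f\<in>V. \<forall>x. \<bar>g x - f x\<bar> < e"
      using reg unfolding regular_form_def by blast
    have "\<exists>f\<in>V. \<forall>x. \<bar>g x - f x\<bar> < 1 / real (Suc n)" for n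
      using dense g by simp
    then obtain f where f: "\<And>n. f n \<in> V" "\<And>n x. \<bar>g x - f n x\<bar> < 1 / real (Suc n)"
      by metis
    obtain B where B: "B > 0" "\<And>x. \<bar>g x\<bar> \<le> B" using C0_bounded[OF g] by blast
    have fh: "(\<lambda>x. f n x * h x) \<in> V" for n using V_mult[OF f(1) h(1)] .
    have "(\<lambda>n. F (\<lambda>x. f n x * h x)) \<longlonglongrightarrow> F g"
    proof (rule conv[where B = "B + 1"])
      show "compact (supp h)" using h(1) C0_compact_supp by blast
      show "(\<lambda>x. f n x * h x) \<in> borel_measurable borel" for n
        using V_continuous[OF fh] by (rule borel_measurable_continuous_onI)
      show "\<bar>f n x * h x\<bar> \<le> B + 1" for n x
      proof -
        have "1 / real (Suc n) \<le> 1" by simp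
        then have "\<bar>f n x\<bar> \<le> B + 1" using f(2)[of x n] B(2)[of x] by linarith
        moreover have "\<bar>f n x * h x\<bar> \<le> \<bar>f n x\<bar> * 1"
          unfolding abs_mult using h(2,3)[of x] by (intro mult_left_mono) auto
        ultimately show ?thesis by simp
      qed
      show "f n x * h x = 0" if "x \<notin> supp h" for n x using eq_0_off_supp[OF that] by simp
      show "(\<lambda>n. f n x * h x) \<longlonglongrightarrow> g x" for x
      proof -
        have "(\<lambda>n. g x - f n x) \<longlonglongrightarrow> 0"
        proof (rule Lim_null_comparison)
          show "\<forall>\<^sub>F n in sequentially. norm (g x - f n x) \<le> 1 / real (Suc n)"
            using f(2)[of x] by (intro always_eventually allI) (simp add: less_imp_le del: of_nat_Suc)
          show "(\<lambda>n. 1 / real (Suc n)) \<longlonglongrightarrow> 0" by (rule LIMSEQ_Suc[OF lim_1_over_n])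
        qed
        then have "(\<lambda>n. (g x - (g x - f n x)) * h x) \<longlonglongrightarrow> (g x - 0) * h x"
          by (intro tendsto_intros)
        then show ?thesis by (simp add: gh)
      qed
    qed
    then show ?thesis by (simp add: FV[OF fh] LIMSEQ_const_iff)
  qed
  obtain l where "closure A \<subseteq> \<Omega> l"
    using eventually_happens'[OF sequentially_bot compact_eventually_subset_Omega[OF A(2)]] by auto
  then have "A \<inter> \<Omega> l = A" using closure_subset by blast
  moreover have "F (indicator (A \<inter> \<Omega> l)) = 0"
    using functional_vanishes_on_borel[OF lin conv zero exhaustion(1,2) A(1)] .
  ultimately have "F (indicator A) = 0" by simp
  then show ?thesis by (simp add: F_def)
qed

lemma Lop_Leibniz:
  assumes u: "u \<in> V" and v: "v \<in> V" and w: "w \<in> V" and f: "f \<in> V"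
  shows "Lop \<E> J K \<sigma> \<Omega> vs (\<lambda>x. u x * v x) w f
    = Lop \<E> J K \<sigma> \<Omega> vs u w (\<lambda>x. v x * f x) + Lop \<E> J K \<sigma> \<Omega> vs v w (\<lambda>x. u x * f x)"
proof -
  let ?wf = "\<lambda>x. w x * f x"
  have eq: "(\<lambda>x. v x * ?wf x) = (\<lambda>x. w x * (v x * f x))" "(\<lambda>x. u x * ?wf x) = (\<lambda>x. w x * (u x * f x))"
    by (simp_all add: mult_ac)
  have half: "(c - c') / 2 = (a - a') / 2 + (b - b') / 2"
    if "a + b - c = a' + b' - c'" for a b c a' b' c' :: real
    using that by (simp add: field_simps)
  show ?thesis
    using energy_Ehatc[OF u v V_mult[OF w f]] unfolding energy_def Lop_def eq by (rule half)
qed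

end

theorem theorem3p3:
  fixes m :: "'a::{metric_space, second_countable_topology} measure"
    and D :: "('a \<Rightarrow> real) set"
    and \<E> :: "('a \<Rightarrow> real) \<Rightarrow> ('a \<Rightarrow> real) \<Rightarrow> real"
    and G :: "real \<Rightarrow> ('a \<Rightarrow> real) \<Rightarrow> ('a \<Rightarrow> real)"
    and J :: "('a \<times> 'a) measure" and K :: "'a measure"
    and \<sigma> :: "real \<Rightarrow> ('a \<times> 'a) measure"
    and \<Omega> :: "nat \<Rightarrow> 'a set" and vs :: "nat \<Rightarrow> real"
    and \<mu> :: "('a \<Rightarrow> real) \<Rightarrow> ('a \<Rightarrow> real) \<Rightarrow> 'a measure \<times> 'a measure"
    and u v w f :: "'a \<Rightarrow> real"
  assumes lc: "locally_compact_space (euclidean :: 'a topology)"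
    and m_radon: "radon_measure m"
    and m_supp: "\<forall>U. open U \<and> U \<noteq> {} \<longrightarrow> emeasure m U > 0"
    and sdf: "semi_dirichlet_form m D \<E>"
    and reg: "regular_form m D \<E>"
    and cores: "co_resolvent m D \<E> G"
    and stand: "standing_assumption D J"
    and JK: "jumping_killing D \<E> J K"
    and sig: "co_resolvent_measures m G \<sigma>"
    and exh: "exhaustion_data J \<Omega> vs"
    and mu: "energy_measures D \<E> J K \<mu>"
    and u: "u \<in> C0 \<inter> D" and v: "v \<in> C0 \<inter> D" and w: "w \<in> C0 \<inter> D" and f: "f \<in> C0 \<inter> D"
  shows "(\<forall>A\<in>sets borel. compact (closure A) \<longrightarrow>
            sint (\<mu> (\<lambda>x. u x * v x) w) (indicator A)
              = sint (\<mu> v w) (\<lambda>x. indicator A x * u x) + sint (\<mu> u w) (\<lambda>x. indicator A x * v x))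
       \<and> Lop \<E> J K \<sigma> \<Omega> vs u (\<lambda>x. v x * w x) f = Lop \<E> J K \<sigma> \<Omega> vs u v (\<lambda>x. w x * f x)
       \<and> Lop \<E> J K \<sigma> \<Omega> vs (\<lambda>x. u x * v x) w f
           = Lop \<E> J K \<sigma> \<Omega> vs u w (\<lambda>x. v x * f x) + Lop \<E> J K \<sigma> \<Omega> vs v w (\<lambda>x. u x * f x)"
proof -
  interpret jump_form m D \<E> G J K \<sigma> \<Omega> vs
    using sdf reg cores stand JK sig exh by unfold_locales
  show ?thesis
  proof (intro conjI ballI impI)
    fix A :: "'a set"
    assume "A \<in> sets borel" "compact (closure A)"
    then show "sint (\<mu> (\<lambda>x. u x * v x) w) (indicator A)
        = sint (\<mu> v w) (\<lambda>x. indicator A x * u x) + sint (\<mu> u w) (\<lambda>x. indicator A x * v x)"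
      by (rule energy_measure_Leibniz[OF mu u v w])
  next
    show "Lop \<E> J K \<sigma> \<Omega> vs u (\<lambda>x. v x * w x) f = Lop \<E> J K \<sigma> \<Omega> vs u v (\<lambda>x. w x * f x)"
      by (simp add: Lop_def mult.assoc)
    show "Lop \<E> J K \<sigma> \<Omega> vs (\<lambda>x. u x * v x) w f
        = Lop \<E> J K \<sigma> \<Omega> vs u w (\<lambda>x. v x * f x) + Lop \<E> J K \<sigma> \<Omega> vs v w (\<lambda>x. u x * f x)"
      by (rule Lop_Leibniz[OF u v w f])
  qed
qed

end
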